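(* Let $I$ be a non-empty index set and $\mathcal{H}$ a Hilbert space. Let $(G_i,M_i)\in\mathbb{M}_2$ for each $i\in I$. For every strongly continuous contractive semigroup $\mathcal{T}$ over $\prod^{\circledast}_{i\in I}M_i$ on $\mathcal{H}$, there exist a Hilbert space $\mathcal{H}'$, an isometry $r:\mathcal{H}\to\mathcal{H}'$, and a strongly continuous unitary representation $\mathcal{U}$ of the topological group $\prod^{\circledast}_{i\in I}G_i$ on $\mathcal{H}'$ such that $$\mathcal{T}(x)=r^{*}\,\mathcal{U}(x)\,r\qquad\text{for all }x\in\prod^{\circledast}_{i\in I}M_i.$$
   Context: Semigroups over monoids: for a topological monoid $(M,\cdot,e)$ and a Hilbert space $\mathcal{H}$, a strongly continuous contractive semigroup over $M$ on $\mathcal{H}$ is a map $T$ from $M$ to the contractions on $\mathcal{H}$ with $T(e)=\mathbf{1}$, $T(xy)=T(x)T(y)$, continuous for the strong operator topology. The class $\mathbb{M}_2$: all pairs $(G,M)$ with $G$ a topological group and $M\subseteq G$ a submonoid with the relative topology, such that for every Hilbert space $H$ and every strongly continuous contractive semigroup $T$ over $M$ on $H$ there exist a Hilbert space $H'$, an isometry $r:H\to H'$ and a strongly continuous unitary representation $U$ of $G$ on $H'$ with $T(x)=r^*U(x)r$ for all $x\in M$. Free topological product: for topological groups $(G_i)_{i\in I}$, it is the (unique up to algebraic and topological isomorphism) topological group $G=\prod^{\circledast}_{i\in I}G_i$ together with continuous homomorphisms $\iota_i:G_i\to G$ such that $G$ is algebraically generated by $\bigcup_i\iota_i(G_i)$,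 and for every topological group $\Gamma$ and continuous homomorphisms $\theta_i:G_i\to\Gamma$ ($i\in I$) there is a continuous homomorphism $\theta:G\to\Gamma$ with $\theta\circ\iota_i=\theta_i$ for all $i$. For submonoids $M_i\subseteq G_i$, $\prod^{\circledast}_{i\in I}M_i$ denotes the submonoid of $G$ of all finite products $\prod_{k=1}^N\iota_{i_k}(x_k)$ with $N\in\mathbb{N}_0$, $i_k\in I$, $x_k\in M_{i_k}$, endowed with the relative topology. *)

theory Defs
  imports "HOL-Analysis.Analysis" "HOL-Algebra.Module" "HOL-Algebra.Generated_Groups"
begin

section \<open>Complex Hilbert spaces\<close>

definition complex_ring :: "complex ring" where
  "complex_ring = \<lparr>carrier = UNIV, mult = (*), one = 1, zero = 0, add = (+)\<rparr>"

lemma cring_complex_ring: "cring complex_ring"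
proof (intro cringI abelian_groupI comm_monoidI)
  fix x :: complex
  show "\<exists>y\<in>carrier complex_ring. y \<oplus>\<^bsub>complex_ring\<^esub> x = \<zero>\<^bsub>complex_ring\<^esub>"
    by (rule bexI[of _ "- x"]) (simp_all add: complex_ring_def)
qed (simp_all add: complex_ring_def algebra_simps)

text \<open>
  The fields \<^const>\<open>mult\<close> and \<^const>\<open>one\<close>, which the record of modules inherits from
  the record of rings, play no role.
\<close>

record 'h inner_product_module = "(complex, 'h) module" +
  cinner :: "'h \<Rightarrow> 'h \<Rightarrow> complex"

definition hnorm :: "'h inner_product_module \<Rightarrow> 'h \<Rightarrow> real" where
  "hnorm H x = sqrt (Re (cinner H x x))"

text \<open>
  The locale \<^locale>\<open>Metric_space\<close> requires a distance to be symmetric and nonnegative on the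
  whole type, hence the cut-off outside the carrier.
\<close>

definition hdist :: "'h inner_product_module \<Rightarrow> 'h \<Rightarrow> 'h \<Rightarrow> real" where
  "hdist H x y = (if x \<in> carrier H \<and> y \<in> carrier H then hnorm H (x \<ominus>\<^bsub>H\<^esub> y) else 0)"

locale complex_inner_product_space = module complex_ring H
  for H :: "'h inner_product_module" (structure) +
  assumes cinner_add_left:
      "\<lbrakk>x \<in> carrier H; y \<in> carrier H; z \<in> carrier H\<rbrakk>
        \<Longrightarrow> cinner H (x \<oplus>\<^bsub>H\<^esub> y) z = cinner H x z + cinner H y z"
    and cinner_smult_left:
      "\<lbrakk>x \<in> carrier H; y \<in> carrier H\<rbrakk> \<Longrightarrow> cinner H (a \<odot>\<^bsub>H\<^esub> x) y = a * cinner H x y"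
    and cinner_commute:
      "\<lbrakk>x \<in> carrier H; y \<in> carrier H\<rbrakk> \<Longrightarrow> cinner H x y = cnj (cinner H y x)"
    and cinner_pos:
      "\<lbrakk>x \<in> carrier H; x \<noteq> \<zero>\<^bsub>H\<^esub>\<rbrakk> \<Longrightarrow> 0 < Re (cinner H x x)"
begin

lemma smult_closed' [simp, intro]: "x \<in> carrier H \<Longrightarrow> a \<odot>\<^bsub>H\<^esub> x \<in> carrier H"
  using smult_closed[of a x] by (simp add: complex_ring_def)

lemma cinner_zero_left [simp]: "y \<in> carrier H \<Longrightarrow> cinner H \<zero>\<^bsub>H\<^esub> y = 0"
  using cinner_add_left[of "\<zero>\<^bsub>H\<^esub>" "\<zero>\<^bsub>H\<^esub>" y] by simp

lemma cinner_add_right: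
  assumes "x \<in> carrier H" "y \<in> carrier H" "z \<in> carrier H"
  shows "cinner H x (y \<oplus>\<^bsub>H\<^esub> z) = cinner H x y + cinner H x z"
  using assms cinner_add_left[of y z x] cinner_commute[of x] by simp

lemma cinner_smult_right:
  assumes "x \<in> carrier H" "y \<in> carrier H"
  shows "cinner H x (a \<odot>\<^bsub>H\<^esub> y) = cnj a * cinner H x y"
  using assms cinner_smult_left[of y x a] cinner_commute[of x] by simp

lemma cinner_minus_left:
  assumes "x \<in> carrier H" "y \<in> carrier H"
  shows "cinner H (\<ominus>\<^bsub>H\<^esub> x) y = - cinner H x y"
  using assms cinner_add_left[of "\<ominus>\<^bsub>H\<^esub> x" x y]
  by (simp add: M.l_neg eq_neg_iff_add_eq_0)

lemma cinner_minus_right: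
  assumes "x \<in> carrier H" "y \<in> carrier H"
  shows "cinner H x (\<ominus>\<^bsub>H\<^esub> y) = - cinner H x y"
  using assms cinner_minus_left[of y x] cinner_commute[of x] by simp

lemma cinner_self_nonneg: "x \<in> carrier H \<Longrightarrow> 0 \<le> Re (cinner H x x)"
  using cinner_pos[of x] by (cases "x = \<zero>\<^bsub>H\<^esub>") auto

lemma Re_cinner_le:
  assumes x: "x \<in> carrier H" and y: "y \<in> carrier H"
  shows "Re (cinner H x y) \<le> hnorm H x * hnorm H y"
proof (cases "y = \<zero>\<^bsub>H\<^esub>")
  case True
  then have "cinner H x y = 0"
    using x cinner_commute[of x y] by simp
  then show ?thesis
    using x y by (simp add: hnorm_def cinner_self_nonneg)
next
  case False
  define A B C where "A = Re (cinner H x x)" and "B = Re (cinner H x y)"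
    and "C = Re (cinner H y y)"
  define t where "t = - (B / C)"
  have C: "C > 0" using cinner_pos[OF y False] by (simp add: C_def)
  have B': "Re (cinner H y x) = B" using cinner_commute[OF y x] by (simp add: B_def)
  define z where "z = x \<oplus>\<^bsub>H\<^esub> (complex_of_real t \<odot>\<^bsub>H\<^esub> y)"
  have "0 \<le> Re (cinner H z z)" using x y by (intro cinner_self_nonneg) (simp add: z_def)
  also have "cinner H z z = cinner H x x + complex_of_real t * cinner H x y
      + complex_of_real t * cinner H y x + complex_of_real (t * t) * cinner H y y"
    using x y by (simp add: z_def cinner_add_left cinner_add_right cinner_smult_left
        cinner_smult_right algebra_simps)
  also have "Re \<dots> = A + 2 * t * B + t * t * C"
    by (simp add: A_def B'[unfolded B_def] B_def C_def)
  finally have "0 \<le> A - B\<^sup>2 / C"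
    using C by (simp add: t_def power2_eq_square field_simps)
  then have "B\<^sup>2 \<le> A * C" using C by (simp add: field_simps)
  then have "B \<le> sqrt (A * C)" by (rule real_le_rsqrt)
  then show ?thesis by (simp add: hnorm_def A_def B_def C_def real_sqrt_mult)
qed

lemma hnorm_triangle:
  assumes x: "x \<in> carrier H" and y: "y \<in> carrier H"
  shows "hnorm H (x \<oplus>\<^bsub>H\<^esub> y) \<le> hnorm H x + hnorm H y"
proof -
  have nn: "0 \<le> hnorm H x" "0 \<le> hnorm H y"
    using x y by (auto simp: hnorm_def cinner_self_nonneg)
  have sq: "(hnorm H x)\<^sup>2 = Re (cinner H x x)" "(hnorm H y)\<^sup>2 = Re (cinner H y y)"
    using x y by (auto simp: hnorm_def cinner_self_nonneg)
  have "Re (cinner H (x \<oplus>\<^bsub>H\<^esub> y) (x \<oplus>\<^bsub>H\<^esub> y))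
      = Re (cinner H x x) + 2 * Re (cinner H x y) + Re (cinner H y y)"
    using x y cinner_commute[OF y x] by (simp add: cinner_add_left cinner_add_right)
  also have "\<dots> \<le> (hnorm H x + hnorm H y)\<^sup>2"
    using Re_cinner_le[OF x y] by (simp add: power2_sum sq)
  finally show ?thesis
    unfolding hnorm_def[of H "x \<oplus>\<^bsub>H\<^esub> y"] using nn by (intro real_le_lsqrt) auto
qed

sublocale Metric_space "carrier H" "hdist H"
proof
  fix x y z
  show "0 \<le> hdist H x y"
    by (auto simp: hdist_def hnorm_def cinner_self_nonneg)
  show "hdist H x y = hdist H y x"
  proof (cases "x \<in> carrier H \<and> y \<in> carrier H")
    case True
    then have "y \<ominus>\<^bsub>H\<^esub> x = \<ominus>\<^bsub>H\<^esub> (x \<ominus>\<^bsub>H\<^esub> y)"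
      by (simp add: a_minus_def M.minus_add M.a_comm)
    then show ?thesis
      using True by (simp add: hdist_def hnorm_def cinner_minus_left cinner_minus_right)
  qed (auto simp: hdist_def)
  assume x: "x \<in> carrier H" and y: "y \<in> carrier H"
  show "(hdist H x y = 0) = (x = y)"
  proof
    assume "hdist H x y = 0"
    then have "Re (cinner H (x \<ominus>\<^bsub>H\<^esub> y) (x \<ominus>\<^bsub>H\<^esub> y)) = 0"
      using x y by (simp add: hdist_def hnorm_def)
    then have "x \<ominus>\<^bsub>H\<^esub> y = \<zero>\<^bsub>H\<^esub>"
      using x y cinner_pos[of "x \<ominus>\<^bsub>H\<^esub> y"] by fastforce
    then show "x = y" using x y
      by (metis a_minus_def M.add.inv_closed M.add.inv_equality M.minus_minus)
  next
    assume "x = y"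
    then show "hdist H x y = 0" using x by (simp add: hdist_def hnorm_def a_minus_def M.r_neg)
  qed
  assume z: "z \<in> carrier H"
  have "x \<ominus>\<^bsub>H\<^esub> z = (x \<ominus>\<^bsub>H\<^esub> y) \<oplus>\<^bsub>H\<^esub> (y \<ominus>\<^bsub>H\<^esub> z)"
    using x y z by (simp add: a_minus_def M.a_assoc M.r_neg1)
  then show "hdist H x z \<le> hdist H x y + hdist H y z"
    using x y z hnorm_triangle[of "x \<ominus>\<^bsub>H\<^esub> y" "y \<ominus>\<^bsub>H\<^esub> z"] by (simp add: hdist_def)
qed

end

locale hilbert_space = complex_inner_product_space +
  assumes complete: mcomplete

definition linear_operator ::
  "'h inner_product_module \<Rightarrow> 'k inner_product_module \<Rightarrow> ('h \<Rightarrow> 'k) \<Rightarrow> bool" where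
  "linear_operator H K f \<longleftrightarrow>
    (\<forall>x\<in>carrier H. f x \<in> carrier K) \<and>
    (\<forall>x\<in>carrier H. \<forall>y\<in>carrier H. f (x \<oplus>\<^bsub>H\<^esub> y) = f x \<oplus>\<^bsub>K\<^esub> f y) \<and>
    (\<forall>a. \<forall>x\<in>carrier H. f (a \<odot>\<^bsub>H\<^esub> x) = a \<odot>\<^bsub>K\<^esub> f x)"

definition contraction :: "'h inner_product_module \<Rightarrow> ('h \<Rightarrow> 'h) \<Rightarrow> bool" where
  "contraction H f \<longleftrightarrow> linear_operator H H f \<and> (\<forall>x\<in>carrier H. hnorm H (f x) \<le> hnorm H x)"

definition linear_isometry ::
  "'h inner_product_module \<Rightarrow> 'k inner_product_module \<Rightarrow> ('h \<Rightarrow> 'k) \<Rightarrow> bool" where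
  "linear_isometry H K r \<longleftrightarrow>
    linear_operator H K r \<and> (\<forall>x\<in>carrier H. hnorm K (r x) = hnorm H x)"

definition unitary_operator :: "'h inner_product_module \<Rightarrow> ('h \<Rightarrow> 'h) \<Rightarrow> bool" where
  "unitary_operator H u \<longleftrightarrow> linear_isometry H H u \<and> u ` carrier H = carrier H"

text \<open>
  For Hilbert spaces \<open>H\<close>, \<open>K\<close> and a bounded operator \<open>f\<close>, the Riesz representation theorem
  gives existence and uniqueness of the described vector.
\<close>

definition adjoint_operator ::
  "'h inner_product_module \<Rightarrow> 'k inner_product_module \<Rightarrow> ('h \<Rightarrow> 'k) \<Rightarrow> 'k \<Rightarrow> 'h" where
  "adjoint_operator H K f \<eta> =
    (THE \<zeta>. \<zeta> \<in> carrier H \<and> (\<forall>\<xi>\<in>carrier H. cinner H \<zeta> \<xi> = cinner K \<eta> (f \<xi>)))"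

section \<open>Topological groups, semigroups and representations\<close>

record 'g top_monoid = "'g monoid" +
  topol :: "'g topology"

locale topological_group = group G for G :: "'g top_monoid" (structure) +
  assumes topspace_topol: "topspace (topol G) = carrier G"
    and continuous_mult:
      "continuous_map (prod_topology (topol G) (topol G)) (topol G) (\<lambda>(x, y). x \<otimes>\<^bsub>G\<^esub> y)"
    and continuous_inv: "continuous_map (topol G) (topol G) (\<lambda>x. inv\<^bsub>G\<^esub> x)"

definition top_submonoid :: "'g top_monoid \<Rightarrow> 'g set \<Rightarrow> 'g top_monoid" where
  "top_submonoid G M = G\<lparr>carrier := M, topol := subtopology (topol G) M\<rparr>"

text \<open>
  Continuity for the strong operator topology is pointwise continuity for the norm topology.
\<close>

definition strongly_continuous ::
  "'g top_monoid \<Rightarrow> 'h inner_product_module \<Rightarrow> ('g \<Rightarrow> 'h \<Rightarrow> 'h) \<Rightarrow> bool" where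
  "strongly_continuous M H T \<longleftrightarrow>
    (\<forall>\<xi>\<in>carrier H. continuous_map (topol M) (Metric_space.mtopology (carrier H) (hdist H))
      (\<lambda>x. T x \<xi>))"

definition operator_homomorphism ::
  "'g top_monoid \<Rightarrow> 'h inner_product_module \<Rightarrow> ('g \<Rightarrow> 'h \<Rightarrow> 'h) \<Rightarrow> bool" where
  "operator_homomorphism M H T \<longleftrightarrow>
    (\<forall>\<xi>\<in>carrier H. T \<one>\<^bsub>M\<^esub> \<xi> = \<xi>) \<and>
    (\<forall>x\<in>carrier M. \<forall>y\<in>carrier M. \<forall>\<xi>\<in>carrier H. T (x \<otimes>\<^bsub>M\<^esub> y) \<xi> = T x (T y \<xi>))"

definition contractive_semigroup ::
  "'g top_monoid \<Rightarrow> 'h inner_product_module \<Rightarrow> ('g \<Rightarrow> 'h \<Rightarrow> 'h) \<Rightarrow> bool" where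
  "contractive_semigroup M H T \<longleftrightarrow>
    (\<forall>x\<in>carrier M. contraction H (T x)) \<and> operator_homomorphism M H T \<and>
    strongly_continuous M H T"

definition unitary_representation ::
  "'g top_monoid \<Rightarrow> 'h inner_product_module \<Rightarrow> ('g \<Rightarrow> 'h \<Rightarrow> 'h) \<Rightarrow> bool" where
  "unitary_representation G H U \<longleftrightarrow>
    (\<forall>x\<in>carrier G. unitary_operator H (U x)) \<and> operator_homomorphism G H U \<and>
    strongly_continuous G H U"

text \<open>
  A quantifier over all Hilbert spaces can only range over those with carrier in a given type:
  \<open>'h\<close> is the type for the spaces that are dilated, \<open>'k\<close> the one for their dilation spaces.
  Whenever a dilation \<open>(H', r, U)\<close> of \<open>T\<close> exists in any type, one exists in
  \<open>'g \<times> 'h \<Rightarrow> complex\<close>, for \<open>'g\<close> the type of the group: restrict \<open>U\<close> to the closed linear span of the vectors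
  \<open>U g (r \<xi>)\<close> and identify a vector \<open>v\<close> of it with the function
  \<open>(g, \<xi>) \<mapsto> cinner H' v (U g (r \<xi>))\<close>.
\<close>

definition class_M2 :: "'h itself \<Rightarrow> 'k itself \<Rightarrow> ('g top_monoid \<times> 'g set) set" where
  "class_M2 _ _ = {(G, M). topological_group G \<and> submonoid M G \<and>
    (\<forall>(H :: 'h inner_product_module) T.
      hilbert_space H \<and> contractive_semigroup (top_submonoid G M) H T \<longrightarrow>
      (\<exists>(H' :: 'k inner_product_module) r U.
        hilbert_space H' \<and> linear_isometry H H' r \<and> unitary_representation G H' U \<and>
        (\<forall>x\<in>M. \<forall>\<xi>\<in>carrier H. T x \<xi> = adjoint_operator H H' r (U x (r \<xi>)))))}"

section \<open>Free topological products\<close>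

definition continuous_hom :: "'g top_monoid \<Rightarrow> 'p top_monoid \<Rightarrow> ('g \<Rightarrow> 'p) \<Rightarrow> bool" where
  "continuous_hom G P f \<longleftrightarrow> f \<in> hom G P \<and> continuous_map (topol G) (topol P) f"

text \<open>
  In the universal property the test groups \<open>\<Gamma>\<close> have their carrier in the type of words over
  the disjoint union of the groups. This is no restriction, because the subgroup of an arbitrary
  \<open>\<Gamma>\<close> generated by the images of the groups consists of values of such words; see
  \<open>free_topological_product_universal\<close> below.
\<close>

definition free_topological_product ::
  "'i set \<Rightarrow> ('i \<Rightarrow> 'g top_monoid) \<Rightarrow> 'p top_monoid \<Rightarrow> ('i \<Rightarrow> 'g \<Rightarrow> 'p) \<Rightarrow> bool" where
  "free_topological_product I G P \<iota> \<longleftrightarrow>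
    topological_group P \<and>
    (\<forall>i\<in>I. continuous_hom (G i) P (\<iota> i)) \<and>
    generate P (\<Union>i\<in>I. \<iota> i ` carrier (G i)) = carrier P \<and>
    (\<forall>(\<Gamma> :: ('i \<times> 'g) list top_monoid) \<theta>.
      topological_group \<Gamma> \<and> (\<forall>i\<in>I. continuous_hom (G i) \<Gamma> (\<theta> i)) \<longrightarrow>
      (\<exists>\<Theta>. continuous_hom P \<Gamma> \<Theta> \<and> (\<forall>i\<in>I. \<forall>x\<in>carrier (G i). \<Theta> (\<iota> i x) = \<theta> i x)))"

definition word_product :: "'p top_monoid \<Rightarrow> ('i \<Rightarrow> 'g \<Rightarrow> 'p) \<Rightarrow> ('i \<times> 'g) list \<Rightarrow> 'p" where
  "word_product P \<iota> w = foldr (\<lambda>(i, x) y. \<iota> i x \<otimes>\<^bsub>P\<^esub> y) w \<one>\<^bsub>P\<^esub>"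

definition free_product_submonoid ::
  "'i set \<Rightarrow> 'p top_monoid \<Rightarrow> ('i \<Rightarrow> 'g \<Rightarrow> 'p) \<Rightarrow> ('i \<Rightarrow> 'g set) \<Rightarrow> 'p set" where
  "free_product_submonoid I P \<iota> M = word_product P \<iota> ` lists (SIGMA i:I. M i)"

lemma (in group) word_product_closed:
  assumes "\<And>i x. i \<in> I \<Longrightarrow> x \<in> C i \<Longrightarrow> \<theta> i x \<in> carrier G" "w \<in> lists (SIGMA i:I. C i)"
  shows "foldr (\<lambda>(i, x) y. \<theta> i x \<otimes> y) w \<one> \<in> carrier G"
  using assms(2) by (induction w) (auto simp: assms(1))

lemma free_topological_product_universal:
  fixes \<Gamma> :: "'c top_monoid" and G :: "'i \<Rightarrow> 'g top_monoid"
  assumes top_grp: "\<And>i. i \<in> I \<Longrightarrow> topological_group (G i)"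
    and free: "free_topological_product I G P \<iota>"
    and Gam: "topological_group \<Gamma>"
    and \<theta>: "\<And>i. i \<in> I \<Longrightarrow> continuous_hom (G i) \<Gamma> (\<theta> i)"
  shows "\<exists>\<Theta>. continuous_hom P \<Gamma> \<Theta> \<and> (\<forall>i\<in>I. \<forall>x\<in>carrier (G i). \<Theta> (\<iota> i x) = \<theta> i x)"
proof -
  have grp: "group (G i)" if "i \<in> I" for i
    using top_grp[OF that] by (rule topological_group.axioms)
  interpret \<Gamma>: topological_group \<Gamma> by fact
  let ?L = "lists (SIGMA i:I. carrier (G i))"
  define ev where "ev = word_product \<Gamma> \<theta>"
  define S where "S = ev ` ?L"
  define f where "f = inv_into ?L ev"
  define A where "A = f ` S"
  have \<theta>c: "\<theta> i x \<in> carrier \<Gamma>" if "i \<in> I" "x \<in> carrier (G i)" for i x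
    using \<theta>[OF that(1)] that(2) by (auto simp: continuous_hom_def hom_def)
  have ev_c: "ev w \<in> carrier \<Gamma>" if "w \<in> ?L" for w
    using \<Gamma>.word_product_closed[of I "\<lambda>i. carrier (G i)" \<theta> w] \<theta>c that
    by (auto simp: ev_def word_product_def)
  have ev_Cons: "ev ((i, x) # w) = \<theta> i x \<otimes>\<^bsub>\<Gamma>\<^esub> ev w" for i x w
    by (simp add: ev_def word_product_def)
  have ev_Nil: "ev [] = \<one>\<^bsub>\<Gamma>\<^esub>" by (simp add: ev_def word_product_def)
  have ev_append: "ev (v @ w) = ev v \<otimes>\<^bsub>\<Gamma>\<^esub> ev w" if "v \<in> ?L" "w \<in> ?L" for v w
    using that(1)
  proof (induction v)
    case Nil
    then show ?case using ev_c[OF that(2)] by (simp add: ev_Nil)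
  next
    case (Cons p v)
    then show ?case
      using ev_c[of v] ev_c[OF that(2)] \<theta>c by (cases p) (auto simp: ev_Cons \<Gamma>.m_assoc)
  qed
  have S_c: "S \<subseteq> carrier \<Gamma>" using ev_c by (auto simp: S_def)
  have S_one: "\<one>\<^bsub>\<Gamma>\<^esub> \<in> S" unfolding S_def by (rule image_eqI[of _ _ "[]"]) (simp_all add: ev_Nil)
  have S_mult: "a \<otimes>\<^bsub>\<Gamma>\<^esub> b \<in> S" if ab: "a \<in> S" "b \<in> S" for a b
  proof -
    obtain v w where "v \<in> ?L" "w \<in> ?L" "a = ev v" "b = ev w"
      using ab unfolding S_def by blast
    then show ?thesis unfolding S_def by (intro image_eqI[of _ _ "v @ w"]) (auto simp: ev_append)
  qed
  have S_\<theta>: "\<theta> i x \<in> S" if "i \<in> I" "x \<in> carrier (G i)" for i x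
    unfolding S_def by (rule image_eqI[of _ _ "[(i, x)]"])
      (use that \<theta>c in \<open>auto simp: ev_Cons ev_Nil\<close>)
  have S_inv: "inv\<^bsub>\<Gamma>\<^esub> a \<in> S" if a: "a \<in> S" for a
  proof -
    obtain w where w: "w \<in> ?L" "a = ev w" using a by (auto simp: S_def)
    have "inv\<^bsub>\<Gamma>\<^esub> (ev w) \<in> S" using w(1)
    proof (induction w)
      case Nil
      then show ?case using S_one by (simp add: ev_Nil)
    next
      case (Cons p w)
      obtain i x where p: "p = (i, x)" by (cases p)
      have ix: "i \<in> I" "x \<in> carrier (G i)" using Cons.hyps p by auto
      have "inv\<^bsub>\<Gamma>\<^esub> (\<theta> i x) = \<theta> i (inv\<^bsub>G i\<^esub> x)"
        using group_hom.hom_inv[of "G i" \<Gamma> "\<theta> i" x] ix grp \<theta>[OF ix(1)]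
        by (simp add: group_hom_def group_hom_axioms_def continuous_hom_def \<Gamma>.is_group)
      then have "inv\<^bsub>\<Gamma>\<^esub> (\<theta> i x) \<in> S"
        using S_\<theta>[OF ix(1), of "inv\<^bsub>G i\<^esub> x"] group.inv_closed[OF grp[OF ix(1)] ix(2)] by simp
      moreover have "inv\<^bsub>\<Gamma>\<^esub> (ev (p # w)) = inv\<^bsub>\<Gamma>\<^esub> (ev w) \<otimes>\<^bsub>\<Gamma>\<^esub> inv\<^bsub>\<Gamma>\<^esub> (\<theta> i x)"
        using ix \<theta>c ev_c[of w] Cons.hyps p by (auto simp: ev_Cons \<Gamma>.inv_mult_group)
      ultimately show ?case using Cons.IH S_mult by simp
    qed
    then show ?thesis using w by simp
  qed
  have ev_f [simp]: "ev (f a) = a" if "a \<in> S" for a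
    using that unfolding f_def S_def by (rule f_inv_into_f)
  have f_ev [simp]: "f (ev u) = u" if "u \<in> A" for u
    using that by (auto simp: A_def)
  have ev_A: "ev u \<in> S" if "u \<in> A" for u using that by (auto simp: A_def)
  have f_A: "f a \<in> A" if "a \<in> S" for a using that by (auto simp: A_def)
  define \<Delta> :: "('i \<times> 'g) list top_monoid" where
    "\<Delta> = \<lparr>carrier = A, mult = (\<lambda>u v. f (ev u \<otimes>\<^bsub>\<Gamma>\<^esub> ev v)), one = f \<one>\<^bsub>\<Gamma>\<^esub>,
          topol = pullback_topology A ev (topol \<Gamma>)\<rparr>"
  have \<Delta> [simp]: "carrier \<Delta> = A" "u \<otimes>\<^bsub>\<Delta>\<^esub> v = f (ev u \<otimes>\<^bsub>\<Gamma>\<^esub> ev v)" "\<one>\<^bsub>\<Delta>\<^esub> = f \<one>\<^bsub>\<Gamma>\<^esub>"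
    "topol \<Delta> = pullback_topology A ev (topol \<Gamma>)" for u v
    by (simp_all add: \<Delta>_def)
  have ev_\<Gamma>: "ev u \<in> carrier \<Gamma>" if "u \<in> A" for u using ev_A[OF that] S_c by auto
  note S_simps = S_mult S_inv S_one ev_A f_A ev_\<Gamma>
  have grp\<Delta>: "group \<Delta>"
  proof (rule groupI)
    fix u v w assume "u \<in> carrier \<Delta>" "v \<in> carrier \<Delta>" "w \<in> carrier \<Delta>"
    then show "u \<otimes>\<^bsub>\<Delta>\<^esub> v \<otimes>\<^bsub>\<Delta>\<^esub> w = u \<otimes>\<^bsub>\<Delta>\<^esub> (v \<otimes>\<^bsub>\<Delta>\<^esub> w)"
      by (simp add: S_simps \<Gamma>.m_assoc)
  next
    fix u assume "u \<in> carrier \<Delta>"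
    then show "\<exists>v\<in>carrier \<Delta>. v \<otimes>\<^bsub>\<Delta>\<^esub> u = \<one>\<^bsub>\<Delta>\<^esub>"
      by (intro bexI[of _ "f (inv\<^bsub>\<Gamma>\<^esub> (ev u))"]) (auto simp: S_simps)
  qed (auto simp: S_simps)
  have inv\<Delta>: "inv\<^bsub>\<Delta>\<^esub> u = f (inv\<^bsub>\<Gamma>\<^esub> (ev u))" if "u \<in> A" for u
    using that by (intro group.inv_equality[OF grp\<Delta>]) (auto simp: S_simps)
  have ts [simp]: "topspace (pullback_topology A ev (topol \<Gamma>)) = A"
    using ev_\<Gamma> by (auto simp: topspace_pullback_topology \<Gamma>.topspace_topol)
  have ev_cont: "continuous_map (topol \<Delta>) (topol \<Gamma>) ev"
    using continuous_map_pullback[of "topol \<Gamma>" "topol \<Gamma>" id A ev] by simp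
  have into_\<Delta>: "continuous_map X (topol \<Delta>) g"
    if "continuous_map X (topol \<Gamma>) h" "\<And>x. x \<in> topspace X \<Longrightarrow> h x = ev (g x)"
      "\<And>x. x \<in> topspace X \<Longrightarrow> g x \<in> A"
    for X :: "'z topology" and g h
  proof -
    have "continuous_map X (topol \<Gamma>) (ev \<circ> g)"
      using that(1) by (rule continuous_map_eq) (simp add: that(2))
    then have "continuous_map X (pullback_topology A ev (topol \<Gamma>)) g"
      by (rule continuous_map_pullback') (use that(3) in auto)
    then show ?thesis by simp
  qed
  have "topological_group \<Delta>"
  proof (intro topological_group.intro topological_group_axioms.intro grp\<Delta>)
    have "continuous_map (prod_topology (topol \<Delta>) (topol \<Delta>)) (topol \<Gamma>)
        ((\<lambda>(x, y). x \<otimes>\<^bsub>\<Gamma>\<^esub> y) \<circ> (\<lambda>(x, y). (ev x, ev y)))"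
      by (rule continuous_map_compose[OF _ \<Gamma>.continuous_mult])
        (use ev_cont in \<open>simp add: continuous_map_prod_top\<close>)
    then show "continuous_map (prod_topology (topol \<Delta>) (topol \<Delta>)) (topol \<Delta>)
        (\<lambda>(x, y). x \<otimes>\<^bsub>\<Delta>\<^esub> y)"
      by (rule into_\<Delta>) (auto simp: S_simps)
    have "continuous_map (topol \<Delta>) (topol \<Gamma>) ((\<lambda>x. inv\<^bsub>\<Gamma>\<^esub> x) \<circ> ev)"
      by (rule continuous_map_compose[OF ev_cont \<Gamma>.continuous_inv])
    then show "continuous_map (topol \<Delta>) (topol \<Delta>) (\<lambda>x. inv\<^bsub>\<Delta>\<^esub> x)"
      by (rule into_\<Delta>) (auto simp: S_simps inv\<Delta>)
  qed simp
  moreover have "continuous_hom (G i) \<Delta> (\<lambda>x. f (\<theta> i x))" if i: "i \<in> I" for i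
    unfolding continuous_hom_def
  proof
    have h: "\<theta> i \<in> hom (G i) \<Gamma>" and c: "continuous_map (topol (G i)) (topol \<Gamma>) (\<theta> i)"
      using \<theta>[OF i] by (auto simp: continuous_hom_def)
    show "(\<lambda>x. f (\<theta> i x)) \<in> hom (G i) \<Delta>"
      using h by (auto simp: hom_def f_A S_\<theta>[OF i])
    show "continuous_map (topol (G i)) (topol \<Delta>) (\<lambda>x. f (\<theta> i x))"
      by (rule into_\<Delta>[OF c])
        (use S_\<theta>[OF i] topological_group.topspace_topol[OF top_grp[OF i]] f_A in auto)
  qed
  ultimately obtain \<Theta> where \<Theta>: "continuous_hom P \<Delta> \<Theta>"
    "\<And>i x. i \<in> I \<Longrightarrow> x \<in> carrier (G i) \<Longrightarrow> \<Theta> (\<iota> i x) = f (\<theta> i x)"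
    using free[unfolded free_topological_product_def]
    by (auto dest!: spec[of _ \<Delta>] spec[of _ "\<lambda>i x. f (\<theta> i x)"])
  have "continuous_hom P \<Gamma> (ev \<circ> \<Theta>)"
    unfolding continuous_hom_def
  proof
    show "ev \<circ> \<Theta> \<in> hom P \<Gamma>"
      using \<Theta>(1) by (auto simp: continuous_hom_def hom_def Pi_iff S_simps)
    show "continuous_map (topol P) (topol \<Gamma>) (ev \<circ> \<Theta>)"
      using \<Theta>(1) ev_cont by (auto simp: continuous_hom_def intro: continuous_map_compose)
  qed
  then show ?thesis
    using \<Theta>(2) S_\<theta> by (intro exI[of _ "ev \<circ> \<Theta>"]) auto
qed

end

theory Submission
  imports Defs
begin

text \<open>
  Each semigroup \<open>T \<circ> \<iota> i\<close> over \<open>M i\<close> has a unitary dilation \<open>(K i, r i, U i)\<close>. It is enough to let all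
  groups \<open>G i\<close> act unitarily on one Hilbert space \<open>S\<close> that contains \<open>H\<close>, in such a way that every
  product of operators coming from elements of the \<open>M i\<close> compresses to the corresponding product of
  operators of \<open>T\<close>: the unitary operators on \<open>S\<close> form a topological group for the strong operator
  topology (\<open>unitary_group_topological_group\<close>), so the universal property joins the actions of the
  factors to a strongly continuous unitary representation of the free product.

  The space \<open>S\<close> contains the orthogonal sum of \<open>H\<close> and the complements of \<open>H\<close> in the \<open>K i\<close>
  (\<open>amalgamated_sum_exists\<close>), and \<open>G i\<close> acts by \<open>U i\<close> on the copy of \<open>K i\<close> and trivially on its
  complement (\<open>unitary_representation_extension\<close>). An element \<open>y\<close> of \<open>M j\<close> moves a vector \<open>\<xi>\<close> of \<open>H\<close>
  to \<open>T (\<iota> j y) \<xi>\<close> plus a component in the complement of \<open>H\<close> in \<open>K j\<close>. The other factors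
  do not move this component. An element \<open>z\<close> of \<open>M j\<close> does, but brings nothing of it back to \<open>H\<close>, since
  what would come back is \<open>T (\<iota> j (z y)) \<xi> - T (\<iota> j z) (T (\<iota> j y) \<xi>) = 0\<close>. So the compression of a product
  can be computed one factor at a time (\<open>compression_of_products\<close>).

  Two constructions serve this argument. The Riesz representation theorem provides the adjoints of
  isometries, which are the projections in the sums above. And every dilation can be replaced by one
  on functions on the group times \<open>H\<close> (\<open>dilation_on_functions\<close>), which is where the conclusion asks
  for it.
\<close>

section \<open>Complex inner product spaces\<close>

context complex_inner_product_space
begin

lemma cinner_zero_right [simp]: "x \<in> carrier H \<Longrightarrow> cinner H x \<zero>\<^bsub>H\<^esub> = 0"
  using cinner_commute[of x "\<zero>\<^bsub>H\<^esub>"] by simp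

lemma cinner_diff_left:
  assumes "x \<in> carrier H" "y \<in> carrier H" "z \<in> carrier H"
  shows "cinner H (x \<ominus>\<^bsub>H\<^esub> y) z = cinner H x z - cinner H y z"
  using assms by (simp add: a_minus_def cinner_add_left cinner_minus_left)

lemma cinner_diff_right:
  assumes "x \<in> carrier H" "y \<in> carrier H" "z \<in> carrier H"
  shows "cinner H z (x \<ominus>\<^bsub>H\<^esub> y) = cinner H z x - cinner H z y"
  using assms by (simp add: a_minus_def cinner_add_right cinner_minus_right)

lemmas cinner_simps = cinner_add_left cinner_add_right cinner_diff_left cinner_diff_right
  cinner_smult_left cinner_smult_right

lemma hnorm_nonneg [simp]: "x \<in> carrier H \<Longrightarrow> 0 \<le> hnorm H x"
  by (simp add: hnorm_def cinner_self_nonneg)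

lemma hnorm_zero [simp]: "hnorm H \<zero>\<^bsub>H\<^esub> = 0"
  by (simp add: hnorm_def)

lemma hnorm_power2: "x \<in> carrier H \<Longrightarrow> (hnorm H x)\<^sup>2 = Re (cinner H x x)"
  by (simp add: hnorm_def cinner_self_nonneg)

lemma cinner_self: "x \<in> carrier H \<Longrightarrow> cinner H x x = complex_of_real ((hnorm H x)\<^sup>2)"
  using cinner_commute[of x x] by (simp add: hnorm_power2 complex_eq_iff)

lemma hdist_eq: "x \<in> carrier H \<Longrightarrow> y \<in> carrier H \<Longrightarrow> hdist H x y = hnorm H (x \<ominus>\<^bsub>H\<^esub> y)"
  by (simp add: hdist_def)

lemma hnorm_eq_zero_iff [simp]: "x \<in> carrier H \<Longrightarrow> hnorm H x = 0 \<longleftrightarrow> x = \<zero>\<^bsub>H\<^esub>"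
  using cinner_pos[of x] by (fastforce simp: hnorm_def)

lemma hnorm_diff_eq_zero: "x \<in> carrier H \<Longrightarrow> y \<in> carrier H \<Longrightarrow> hnorm H (x \<ominus>\<^bsub>H\<^esub> y) = 0 \<longleftrightarrow> x = y"
  by (metis hdist_eq zero)

lemma hnorm_smult: "x \<in> carrier H \<Longrightarrow> hnorm H (a \<odot>\<^bsub>H\<^esub> x) = cmod a * hnorm H x"
proof -
  assume x: "x \<in> carrier H"
  have "cinner H (a \<odot>\<^bsub>H\<^esub> x) (a \<odot>\<^bsub>H\<^esub> x) = a * cnj a * cinner H x x"
    using x by (simp add: cinner_smult_left cinner_smult_right)
  also have "\<dots> = complex_of_real ((cmod a)\<^sup>2 * (hnorm H x)\<^sup>2)"
    using x by (simp add: cinner_self complex_norm_square del: of_real_power)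
  finally have "cinner H (a \<odot>\<^bsub>H\<^esub> x) (a \<odot>\<^bsub>H\<^esub> x) = complex_of_real ((cmod a)\<^sup>2 * (hnorm H x)\<^sup>2)" .
  then have "Re (cinner H (a \<odot>\<^bsub>H\<^esub> x) (a \<odot>\<^bsub>H\<^esub> x)) = (cmod a * hnorm H x)\<^sup>2"
    by (simp only: Re_complex_of_real power_mult_distrib)
  then show ?thesis using x by (simp add: hnorm_def[of H "a \<odot>\<^bsub>H\<^esub> x"])
qed

text \<open>
  With this rule an identity between vectors becomes an identity between complex numbers, for
  which the simplifier is much better equipped.
\<close>

lemma vector_eqI:
  assumes "x \<in> carrier H" "y \<in> carrier H"
    and "\<And>z. z \<in> carrier H \<Longrightarrow> cinner H x z = cinner H y z"
  shows "x = y"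
proof -
  have "cinner H (x \<ominus>\<^bsub>H\<^esub> y) (x \<ominus>\<^bsub>H\<^esub> y) = 0"
    using assms by (simp add: cinner_diff_left)
  then have "hnorm H (x \<ominus>\<^bsub>H\<^esub> y) = 0" by (simp add: hnorm_def)
  then show ?thesis using assms(1,2) by (simp add: hnorm_diff_eq_zero del: hnorm_eq_zero_iff)
qed

lemma cmod_cinner_le:
  assumes x: "x \<in> carrier H" and y: "y \<in> carrier H"
  shows "cmod (cinner H x y) \<le> hnorm H x * hnorm H y"
proof (cases "cinner H x y = 0")
  case True
  then show ?thesis using x y by simp
next
  case False
  \<comment> \<open>Rotate \<open>x\<close> so that the inner product becomes real.\<close>
  define u where "u = cnj (sgn (cinner H x y))"
  have "cinner H (u \<odot>\<^bsub>H\<^esub> x) y = complex_of_real (cmod (cinner H x y))"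
    using x y False complex_norm_square[of "cinner H x y"]
    by (simp add: cinner_smult_left u_def sgn_eq divide_simps power2_eq_square mult.commute)
  then have "cmod (cinner H x y) = Re (cinner H (u \<odot>\<^bsub>H\<^esub> x) y)" by simp
  also have "\<dots> \<le> hnorm H (u \<odot>\<^bsub>H\<^esub> x) * hnorm H y"
    using x y by (intro Re_cinner_le) auto
  also have "\<dots> = hnorm H x * hnorm H y"
    using False x by (simp add: hnorm_smult u_def norm_sgn)
  finally show ?thesis .
qed

lemma minus_eq_smult: "x \<in> carrier H \<Longrightarrow> \<ominus>\<^bsub>H\<^esub> x = (- 1) \<odot>\<^bsub>H\<^esub> x"
  by (rule vector_eqI) (auto simp: cinner_minus_left cinner_smult_left)

lemma diff_eq_smult: "x \<in> carrier H \<Longrightarrow> y \<in> carrier H \<Longrightarrow> x \<ominus>\<^bsub>H\<^esub> y = x \<oplus>\<^bsub>H\<^esub> (- 1) \<odot>\<^bsub>H\<^esub> y"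
  by (simp add: a_minus_def minus_eq_smult)

lemma cinner_limit:
  assumes \<sigma>: "\<And>n. \<sigma> n \<in> carrier H" and l: "l \<in> carrier H" and y: "y \<in> carrier H"
    and lim: "(\<lambda>n. hnorm H (\<sigma> n \<ominus>\<^bsub>H\<^esub> l)) \<longlonglongrightarrow> 0"
  shows "(\<lambda>n. cinner H (\<sigma> n) y) \<longlonglongrightarrow> cinner H l y"
proof (rule LIM_zero_cancel, rule Lim_null_comparison)
  show "eventually (\<lambda>n. norm (cinner H (\<sigma> n) y - cinner H l y)
      \<le> hnorm H (\<sigma> n \<ominus>\<^bsub>H\<^esub> l) * hnorm H y) sequentially"
    using cmod_cinner_le[of "\<sigma> _ \<ominus>\<^bsub>H\<^esub> l" y] \<sigma> l y
    by (intro always_eventually allI) (simp add: cinner_diff_left)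
  show "(\<lambda>n. hnorm H (\<sigma> n \<ominus>\<^bsub>H\<^esub> l) * hnorm H y) \<longlonglongrightarrow> 0"
    using tendsto_mult_right[OF lim, of "hnorm H y"] by simp
qed

lemma hilbert_spaceI:
  assumes "\<And>\<sigma>. \<lbrakk>\<And>n. \<sigma> n \<in> carrier H;
      \<And>e. e > 0 \<Longrightarrow> \<exists>N. \<forall>m\<ge>N. \<forall>n\<ge>N. hnorm H (\<sigma> m \<ominus>\<^bsub>H\<^esub> \<sigma> n) < e\<rbrakk>
    \<Longrightarrow> \<exists>l\<in>carrier H. (\<lambda>n. hnorm H (\<sigma> n \<ominus>\<^bsub>H\<^esub> l)) \<longlonglongrightarrow> 0"
  shows "hilbert_space H"
proof
  show mcomplete
    unfolding mcomplete_def
  proof (intro strip)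
    fix \<sigma> assume "MCauchy \<sigma>"
    then have \<sigma>: "\<sigma> n \<in> carrier H" for n by (auto simp: MCauchy_def)
    have "\<exists>N. \<forall>m\<ge>N. \<forall>n\<ge>N. hnorm H (\<sigma> m \<ominus>\<^bsub>H\<^esub> \<sigma> n) < e" if "e > 0" for e
      using \<open>MCauchy \<sigma>\<close> that \<sigma> unfolding MCauchy_def by (fastforce simp: hdist_eq)
    with \<sigma> have "\<exists>l\<in>carrier H. (\<lambda>n. hnorm H (\<sigma> n \<ominus>\<^bsub>H\<^esub> l)) \<longlonglongrightarrow> 0"
      by (rule assms)
    then obtain l where "l \<in> carrier H" "(\<lambda>n. hnorm H (\<sigma> n \<ominus>\<^bsub>H\<^esub> l)) \<longlonglongrightarrow> 0" ..
    then show "\<exists>x. limitin mtopology \<sigma> x sequentially"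
      using \<sigma> by (auto simp: limitin_metric_dist_null hdist_eq)
  qed
qed

end

lemma (in hilbert_space) cauchy_limit:
  assumes \<sigma>: "\<And>n. \<sigma> n \<in> carrier H"
    and "\<And>e. e > 0 \<Longrightarrow> \<exists>N. \<forall>m\<ge>N. \<forall>n\<ge>N. hnorm H (\<sigma> m \<ominus>\<^bsub>H\<^esub> \<sigma> n) < e"
  obtains l where "l \<in> carrier H" "(\<lambda>n. hnorm H (\<sigma> n \<ominus>\<^bsub>H\<^esub> l)) \<longlonglongrightarrow> 0"
proof -
  have "\<exists>N. \<forall>n n'. N \<le> n \<longrightarrow> N \<le> n' \<longrightarrow> hdist H (\<sigma> n) (\<sigma> n') < e" if e: "e > 0" for e
  proof -
    obtain N where "\<And>m n. m \<ge> N \<Longrightarrow> n \<ge> N \<Longrightarrow> hnorm H (\<sigma> m \<ominus>\<^bsub>H\<^esub> \<sigma> n) < e"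
      using assms(2)[OF e] by metis
    then show ?thesis by (intro exI[of _ N]) (simp add: hdist_eq \<sigma>)
  qed
  then have "MCauchy \<sigma>"
    using \<sigma> by (auto simp: MCauchy_def)
  then obtain l where "limitin mtopology \<sigma> l sequentially"
    using complete by (auto simp: mcomplete_def)
  then show thesis
    using that[of l] \<sigma> by (auto simp: limitin_metric_dist_null hdist_eq)
qed

section \<open>Linear operators and adjoints\<close>

lemma linear_operatorD:
  assumes "linear_operator H K f"
  shows "x \<in> carrier H \<Longrightarrow> f x \<in> carrier K"
    and "x \<in> carrier H \<Longrightarrow> y \<in> carrier H \<Longrightarrow> f (x \<oplus>\<^bsub>H\<^esub> y) = f x \<oplus>\<^bsub>K\<^esub> f y"
    and "x \<in> carrier H \<Longrightarrow> f (a \<odot>\<^bsub>H\<^esub> x) = a \<odot>\<^bsub>K\<^esub> f x"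
  using assms by (auto simp: linear_operator_def)

lemma linear_operator_diff:
  assumes "complex_inner_product_space H" "complex_inner_product_space K" "linear_operator H K f"
    and x: "x \<in> carrier H" and y: "y \<in> carrier H"
  shows "f (x \<ominus>\<^bsub>H\<^esub> y) = f x \<ominus>\<^bsub>K\<^esub> f y"
proof -
  interpret H: complex_inner_product_space H by fact
  interpret K: complex_inner_product_space K by fact
  show ?thesis
    using x y linear_operatorD[OF assms(3)] by (simp add: H.diff_eq_smult K.diff_eq_smult)
qed

lemma linear_isometryD:
  assumes "linear_isometry H K f"
  shows "linear_operator H K f" "x \<in> carrier H \<Longrightarrow> hnorm K (f x) = hnorm H x"
    "x \<in> carrier H \<Longrightarrow> f x \<in> carrier K"
  using assms by (auto simp: linear_isometry_def linear_operator_def)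

lemma linear_isometryI:
  assumes "complex_inner_product_space H" "complex_inner_product_space K"
    and "linear_operator H K f"
    and "\<And>x. x \<in> carrier H \<Longrightarrow> cinner K (f x) (f x) = cinner H x x"
  shows "linear_isometry H K f"
  using assms by (simp add: linear_isometry_def hnorm_def)

text \<open>
  Polarization: the real parts of the inner products are read off from the norms of sums, and
  replacing \<open>x\<close> by \<open>\<i> x\<close> turns imaginary parts into real ones.
\<close>

lemma linear_isometry_cinner:
  assumes "complex_inner_product_space H" "complex_inner_product_space K"
    and f: "linear_isometry H K f"
    and x: "x \<in> carrier H" and y: "y \<in> carrier H"
  shows "cinner K (f x) (f y) = cinner H x y"
proof -
  interpret H: complex_inner_product_space H by fact
  interpret K: complex_inner_product_space K by fact
  note f' = linear_isometryD[OF f] linear_operatorD[OF linear_isometryD(1)[OF f]]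
  have Re: "Re (cinner K (f u) (f y)) = Re (cinner H u y)" if u: "u \<in> carrier H" for u
  proof -
    have "(hnorm K (f (u \<oplus>\<^bsub>H\<^esub> y)))\<^sup>2 = (hnorm H (u \<oplus>\<^bsub>H\<^esub> y))\<^sup>2"
      using u y by (simp add: f'(2) del: f'(5))
    moreover have "Re (cinner K (f u) (f u)) = Re (cinner H u u)"
      "Re (cinner K (f y) (f y)) = Re (cinner H y y)"
      using u y by (simp_all add: f' flip: H.hnorm_power2 K.hnorm_power2)
    ultimately show ?thesis
      using u y H.cinner_commute[OF y u] K.cinner_commute[of "f y" "f u"]
      by (simp add: H.hnorm_power2 K.hnorm_power2 f' H.cinner_simps K.cinner_simps)
  qed
  have "Im (cinner K (f x) (f y)) = Im (cinner H x y)"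
    using Re[of "\<i> \<odot>\<^bsub>H\<^esub> x"] x y by (simp add: f' H.cinner_simps K.cinner_simps)
  then show ?thesis using Re[OF x] by (simp add: complex_eq_iff)
qed

text \<open>
  The functional is antilinear, and the vector representing it minimizes
  \<open>\<parallel>x\<parallel>\<^sup>2 - 2 Re (\<phi> x)\<close>: minimizing sequences are Cauchy by the parallelogram law, and the derivative
  at the minimum vanishes in every direction.
\<close>

theorem (in hilbert_space) riesz_representation:
  assumes add: "\<And>x y. x \<in> carrier H \<Longrightarrow> y \<in> carrier H \<Longrightarrow> \<phi> (x \<oplus>\<^bsub>H\<^esub> y) = \<phi> x + \<phi> y"
    and smult: "\<And>a x. x \<in> carrier H \<Longrightarrow> \<phi> (a \<odot>\<^bsub>H\<^esub> x) = cnj a * \<phi> x"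
    and bound: "\<And>x. x \<in> carrier H \<Longrightarrow> cmod (\<phi> x) \<le> C * hnorm H x"
  shows "\<exists>z\<in>carrier H. \<forall>x\<in>carrier H. cinner H z x = \<phi> x"
proof -
  define q where "q x = (hnorm H x)\<^sup>2 - 2 * Re (\<phi> x)" for x
  define m where "m = Inf (q ` carrier H)"
  have lower: "- C\<^sup>2 \<le> q x" if "x \<in> carrier H" for x
    using bound[OF that] complex_Re_le_cmod[of "\<phi> x"] zero_le_power2[of "hnorm H x - C"]
    by (simp add: q_def power2_diff algebra_simps)
  then have bdd: "bdd_below (q ` carrier H)" by (intro bdd_belowI2[of _ "- C\<^sup>2"])
  have m_le: "m \<le> q x" if "x \<in> carrier H" for x
    unfolding m_def using that bdd by (intro cInf_lower) auto
  have "\<exists>z\<in>carrier H. q z < m + inverse (real (Suc n))" for n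
    using cInf_lessD[of "q ` carrier H" "m + inverse (real (Suc n))"]
    by (auto simp: m_def)
  then obtain z where z: "\<And>n. z n \<in> carrier H" "\<And>n. q (z n) < m + inverse (real (Suc n))"
    by metis
  have par: "(hnorm H (x \<ominus>\<^bsub>H\<^esub> y))\<^sup>2 \<le> 2 * (q x + q y - 2 * m)"
    if x: "x \<in> carrier H" and y: "y \<in> carrier H" for x y
  proof -
    let ?c = "(1/2) \<odot>\<^bsub>H\<^esub> (x \<oplus>\<^bsub>H\<^esub> y)"
    have "(hnorm H (x \<ominus>\<^bsub>H\<^esub> y))\<^sup>2 = 2 * (q x + q y - 2 * q ?c)"
      using x y by (simp add: q_def hnorm_power2 cinner_simps add smult algebra_simps)
    then show ?thesis using m_le[of ?c] x y by simp
  qed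
  have "\<exists>N. \<forall>n\<ge>N. \<forall>n'\<ge>N. hnorm H (z n \<ominus>\<^bsub>H\<^esub> z n') < e" if e: "e > 0" for e :: real
  proof -
    obtain N where N: "inverse (real (Suc N)) < e\<^sup>2 / 4"
      using reals_Archimedean[of "e\<^sup>2 / 4"] e by auto
    have *: "q (z k) < m + e\<^sup>2 / 4" if "N \<le> k" for k
    proof -
      have "q (z k) < m + inverse (real (Suc k))" by (rule z)
      also have "\<dots> \<le> m + inverse (real (Suc N))"
        using that by (auto intro!: le_imp_inverse_le)
      also have "\<dots> < m + e\<^sup>2 / 4" using N by simp
      finally show ?thesis .
    qed
    have "hnorm H (z n \<ominus>\<^bsub>H\<^esub> z n') < e" if "N \<le> n" "N \<le> n'" for n n'
    proof -
      have "(hnorm H (z n \<ominus>\<^bsub>H\<^esub> z n'))\<^sup>2 < e\<^sup>2"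
        using par[OF z(1) z(1), of n n'] *[of n] *[of n'] that by simp
      then show ?thesis using e by (simp add: power_less_imp_less_base)
    qed
    then show ?thesis by blast
  qed
  then obtain l where l: "l \<in> carrier H" and lim: "(\<lambda>n. hnorm H (z n \<ominus>\<^bsub>H\<^esub> l)) \<longlonglongrightarrow> 0"
    using cauchy_limit[of z] z(1) by metis
  have Re: "Re (cinner H l x) = Re (\<phi> x)" if x: "x \<in> carrier H" for x
  proof -
    define D where "D = Re (cinner H l x) - Re (\<phi> x)"
    define a where "a = (hnorm H x)\<^sup>2"
    have a: "0 \<le> a" by (simp add: a_def)
    have ineq: "0 \<le> t * t * a + 2 * t * D" for t
    proof (rule LIMSEQ_le_const)
      show "(\<lambda>n. inverse (real (Suc n)) + (t * t * a
          + 2 * t * (Re (cinner H (z n) x) - Re (\<phi> x)))) \<longlonglongrightarrow> t * t * a + 2 * t * D"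
        unfolding D_def
        by (rule tendsto_eq_intros LIMSEQ_inverse_real_of_nat cinner_limit[OF z(1) l x lim] refl)+ simp
      have "0 \<le> inverse (real (Suc n)) + (t * t * a
          + 2 * t * (Re (cinner H (z n) x) - Re (\<phi> x)))" for n
      proof -
        let ?y = "z n \<oplus>\<^bsub>H\<^esub> (complex_of_real t \<odot>\<^bsub>H\<^esub> x)"
        have "q ?y = q (z n) + (t * t * a + 2 * t * (Re (cinner H (z n) x) - Re (\<phi> x)))"
          using x z(1)[of n] cinner_commute[of x "z n"]
          by (simp add: q_def a_def hnorm_power2 cinner_simps add smult algebra_simps)
        then show ?thesis using m_le[of ?y] z[of n] x by simp
      qed
      then show "\<exists>N. \<forall>n\<ge>N. 0 \<le> inverse (real (Suc n)) + (t * t * a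
          + 2 * t * (Re (cinner H (z n) x) - Re (\<phi> x)))" by blast
    qed
    \<comment> \<open>A step against the slope \<open>2 D\<close>, short enough for the quadratic term not to outweigh the gain.\<close>
    define t where "t = - D / (a + 1)"
    have "t * t * a + 2 * t * D = - (D * D * (a + 2)) / ((a + 1) * (a + 1))"
      using a unfolding t_def by (simp add: divide_simps) (simp add: algebra_simps)
    then have "0 \<le> - (D * D * (a + 2)) / ((a + 1) * (a + 1))" using ineq[of t] by simp
    then have "D = 0" using a by (auto simp: divide_le_0_iff mult_le_0_iff)
    then show ?thesis by (simp add: D_def)
  qed
  have "cinner H l x = \<phi> x" if x: "x \<in> carrier H" for x
    using Re[OF x] Re[of "\<i> \<odot>\<^bsub>H\<^esub> x"] x l by (simp add: complex_eq_iff cinner_simps smult)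
  then show ?thesis using l by auto
qed

text \<open>
  For an isometry \<open>r\<close>, the adjoint is the orthogonal projection onto the range followed by the inverse
  of \<open>r\<close>; it is the compression to \<open>H\<close> when \<open>H\<close> is regarded as a subspace of \<open>K\<close>.
\<close>

locale isometry_of_hilbert_spaces = H: hilbert_space H + K: complex_inner_product_space K
  for H :: "'h inner_product_module" and K :: "'k inner_product_module" +
  fixes r :: "'h \<Rightarrow> 'k"
  assumes isometry: "linear_isometry H K r"
begin

lemmas linear = linear_isometryD(1)[OF isometry]

lemma closed [simp]: "x \<in> carrier H \<Longrightarrow> r x \<in> carrier K"
  by (rule linear_isometryD(3)[OF isometry])

lemma cinner_image: "x \<in> carrier H \<Longrightarrow> y \<in> carrier H \<Longrightarrow> cinner K (r x) (r y) = cinner H x y"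
  by (rule linear_isometry_cinner[OF _ _ isometry]) unfold_locales

abbreviation adj :: "'k \<Rightarrow> 'h" where "adj \<equiv> adjoint_operator H K r"

lemma adj_unique:
  assumes "z \<in> carrier H" "\<And>x. x \<in> carrier H \<Longrightarrow> cinner H z x = cinner K y (r x)"
  shows "adj y = z"
  unfolding adjoint_operator_def
  by (rule the_equality) (use assms in \<open>auto intro: H.vector_eqI\<close>)

lemma adj_exists:
  assumes y: "y \<in> carrier K"
  shows "adj y \<in> carrier H \<and> (\<forall>x\<in>carrier H. cinner H (adj y) x = cinner K y (r x))"
proof -
  have "\<exists>z\<in>carrier H. \<forall>x\<in>carrier H. cinner H z x = cinner K y (r x)"
  proof (rule H.riesz_representation)
    show "cmod (cinner K y (r x)) \<le> hnorm K y * hnorm H x" if "x \<in> carrier H" for x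
      using K.cmod_cinner_le[OF y, of "r x"] that linear_isometryD[OF isometry] by simp
  qed (use y linear_operatorD[OF linear] in \<open>auto simp: K.cinner_simps\<close>)
  then show ?thesis using adj_unique by metis
qed

lemma adj_closed [simp]: "y \<in> carrier K \<Longrightarrow> adj y \<in> carrier H"
  using adj_exists by blast

lemma cinner_adj: "y \<in> carrier K \<Longrightarrow> x \<in> carrier H \<Longrightarrow> cinner H (adj y) x = cinner K y (r x)"
  using adj_exists by blast

lemma cinner_adj_right:
  "y \<in> carrier K \<Longrightarrow> x \<in> carrier H \<Longrightarrow> cinner H x (adj y) = cinner K (r x) y"
  using cinner_adj[of y x] H.cinner_commute[of x "adj y"] K.cinner_commute[of "r x" y] by simp

lemma adj_image [simp]: "x \<in> carrier H \<Longrightarrow> adj (r x) = x"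
  by (rule adj_unique) (auto simp: cinner_image)

lemma adj_linear: "linear_operator K H adj"
  unfolding linear_operator_def
  by (auto intro!: H.vector_eqI simp: cinner_adj H.cinner_simps K.cinner_simps)

lemma adj_add:
  "x \<in> carrier K \<Longrightarrow> y \<in> carrier K \<Longrightarrow> adj (x \<oplus>\<^bsub>K\<^esub> y) = adj x \<oplus>\<^bsub>H\<^esub> adj y"
  using linear_operatorD[OF adj_linear] by blast

lemma adj_diff:
  "x \<in> carrier K \<Longrightarrow> y \<in> carrier K \<Longrightarrow> adj (x \<ominus>\<^bsub>K\<^esub> y) = adj x \<ominus>\<^bsub>H\<^esub> adj y"
  by (rule linear_operator_diff[OF _ _ adj_linear]) unfold_locales

end

section \<open>Hilbert sums\<close>

text \<open>
  The Hilbert spaces below are built from given ones: sums, subspaces and isomorphic copies. All of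
  them have a family of linear maps into inner product spaces that separates points, and the vector
  space axioms are pulled back along these maps.
\<close>

lemmas complex_inner_product_space_abelian_monoid =
  abelian_group.axioms(1)[OF module.axioms(2)[OF complex_inner_product_space.axioms(1)]]

lemma module_of_separating_maps:
  fixes V :: "'v inner_product_module" and K :: "'j \<Rightarrow> 'k inner_product_module"
  assumes K: "\<And>j. j \<in> J \<Longrightarrow> complex_inner_product_space (K j)"
    and zero: "\<zero>\<^bsub>V\<^esub> \<in> carrier V"
    and add: "\<And>x y. x \<in> carrier V \<Longrightarrow> y \<in> carrier V \<Longrightarrow> x \<oplus>\<^bsub>V\<^esub> y \<in> carrier V"
    and smult: "\<And>a x. x \<in> carrier V \<Longrightarrow> a \<odot>\<^bsub>V\<^esub> x \<in> carrier V"
    and p: "\<And>j x. j \<in> J \<Longrightarrow> x \<in> carrier V \<Longrightarrow> p j x \<in> carrier (K j)"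
    and p_zero: "\<And>j. j \<in> J \<Longrightarrow> p j \<zero>\<^bsub>V\<^esub> = \<zero>\<^bsub>K j\<^esub>"
    and p_add: "\<And>j x y. j \<in> J \<Longrightarrow> x \<in> carrier V \<Longrightarrow> y \<in> carrier V \<Longrightarrow> p j (x \<oplus>\<^bsub>V\<^esub> y) = p j x \<oplus>\<^bsub>K j\<^esub> p j y"
    and p_smult: "\<And>j a x. j \<in> J \<Longrightarrow> x \<in> carrier V \<Longrightarrow> p j (a \<odot>\<^bsub>V\<^esub> x) = a \<odot>\<^bsub>K j\<^esub> p j x"
    and separating: "\<And>x y. x \<in> carrier V \<Longrightarrow> y \<in> carrier V \<Longrightarrow> (\<And>j. j \<in> J \<Longrightarrow> p j x = p j y) \<Longrightarrow> x = y"
  shows "module complex_ring V"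
proof -
  have eqI: "x = y" if xy: "x \<in> carrier V" "y \<in> carrier V"
    and eq: "\<And>j z. j \<in> J \<Longrightarrow> z \<in> carrier (K j) \<Longrightarrow> cinner (K j) (p j x) z = cinner (K j) (p j y) z"
    for x y
    using xy by (rule separating)
      (use K p xy eq in \<open>blast intro: complex_inner_product_space.vector_eqI\<close>)
  note simps = add smult p zero p_zero p_add p_smult
    complex_inner_product_space.cinner_simps[OF K] complex_inner_product_space.smult_closed'[OF K]
    complex_inner_product_space.cinner_zero_left[OF K]
    abelian_monoid.a_closed[OF complex_inner_product_space_abelian_monoid[OF K]]
    abelian_monoid.zero_closed[OF complex_inner_product_space_abelian_monoid[OF K]]
  show ?thesis
  proof (intro moduleI abelian_groupI)
    show "cring complex_ring" by (rule cring_complex_ring)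
  next
    fix x assume x: "x \<in> carrier V"
    show "\<exists>y\<in>carrier V. y \<oplus>\<^bsub>V\<^esub> x = \<zero>\<^bsub>V\<^esub>"
      using x by (intro bexI[of _ "(-1) \<odot>\<^bsub>V\<^esub> x"] eqI) (auto simp: simps)
  qed (auto intro!: eqI simp: simps complex_ring_def algebra_simps)
qed

definition hilbert_sum ::
  "'j set \<Rightarrow> ('j \<Rightarrow> 'k inner_product_module) \<Rightarrow> ('j \<Rightarrow> 'k) inner_product_module" where
  "hilbert_sum J K =
    \<lparr>carrier = {x \<in> \<Pi>\<^sub>E j\<in>J. carrier (K j). (\<lambda>j. (hnorm (K j) (x j))\<^sup>2) summable_on J},
     mult = undefined, one = undefined,
     zero = (\<lambda>j\<in>J. \<zero>\<^bsub>K j\<^esub>), add = (\<lambda>x y. \<lambda>j\<in>J. x j \<oplus>\<^bsub>K j\<^esub> y j),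
     smult = (\<lambda>a x. \<lambda>j\<in>J. a \<odot>\<^bsub>K j\<^esub> x j),
     cinner = (\<lambda>x y. \<Sum>\<^sub>\<infinity>j\<in>J. cinner (K j) (x j) (y j))\<rparr>"

definition sum_inclusion ::
  "'j set \<Rightarrow> ('j \<Rightarrow> 'k inner_product_module) \<Rightarrow> 'j \<Rightarrow> 'k \<Rightarrow> 'j \<Rightarrow> 'k" where
  "sum_inclusion J K j u = (\<lambda>k\<in>J. if k = j then u else \<zero>\<^bsub>K k\<^esub>)"

locale hilbert_space_family =
  fixes J :: "'j set" and K :: "'j \<Rightarrow> 'k inner_product_module"
  assumes hilbert: "\<And>j. j \<in> J \<Longrightarrow> hilbert_space (K j)"
begin

abbreviation S :: "('j \<Rightarrow> 'k) inner_product_module" where "S \<equiv> hilbert_sum J K"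

lemma ips: "j \<in> J \<Longrightarrow> complex_inner_product_space (K j)"
  by (rule hilbert_space.axioms(1)[OF hilbert])

lemma closures:
  assumes "j \<in> J" "x \<in> carrier (K j)"
  shows "y \<in> carrier (K j) \<Longrightarrow> x \<oplus>\<^bsub>K j\<^esub> y \<in> carrier (K j)"
    and "y \<in> carrier (K j) \<Longrightarrow> x \<ominus>\<^bsub>K j\<^esub> y \<in> carrier (K j)"
    and "a \<odot>\<^bsub>K j\<^esub> x \<in> carrier (K j)"
proof -
  interpret complex_inner_product_space "K j" by (rule ips) fact
  show "y \<in> carrier (K j) \<Longrightarrow> x \<oplus>\<^bsub>K j\<^esub> y \<in> carrier (K j)"
    and "y \<in> carrier (K j) \<Longrightarrow> x \<ominus>\<^bsub>K j\<^esub> y \<in> carrier (K j)"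
    and "a \<odot>\<^bsub>K j\<^esub> x \<in> carrier (K j)"
    using assms by auto
qed

lemma zero_closed: "j \<in> J \<Longrightarrow> \<zero>\<^bsub>K j\<^esub> \<in> carrier (K j)"
  by (rule abelian_monoid.zero_closed[OF complex_inner_product_space_abelian_monoid[OF ips]])

lemma sum_simps:
  "\<zero>\<^bsub>S\<^esub> = (\<lambda>j\<in>J. \<zero>\<^bsub>K j\<^esub>)" "x \<oplus>\<^bsub>S\<^esub> y = (\<lambda>j\<in>J. x j \<oplus>\<^bsub>K j\<^esub> y j)"
  "a \<odot>\<^bsub>S\<^esub> x = (\<lambda>j\<in>J. a \<odot>\<^bsub>K j\<^esub> x j)" "cinner S x y = (\<Sum>\<^sub>\<infinity>j\<in>J. cinner (K j) (x j) (y j))"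
  by (simp_all add: hilbert_sum_def)

lemma carrier_iff:
  "x \<in> carrier S \<longleftrightarrow>
    x \<in> (\<Pi>\<^sub>E j\<in>J. carrier (K j)) \<and> (\<lambda>j. (hnorm (K j) (x j))\<^sup>2) summable_on J"
  by (simp add: hilbert_sum_def)

lemma component: "x \<in> carrier S \<Longrightarrow> j \<in> J \<Longrightarrow> x j \<in> carrier (K j)"
  by (auto simp: carrier_iff)

lemma add_in:
  assumes x: "x \<in> carrier S" and y: "y \<in> carrier S"
  shows "(\<lambda>j\<in>J. x j \<oplus>\<^bsub>K j\<^esub> y j) \<in> carrier S"
  unfolding carrier_iff
proof
  show "(\<lambda>j\<in>J. x j \<oplus>\<^bsub>K j\<^esub> y j) \<in> (\<Pi>\<^sub>E j\<in>J. carrier (K j))"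
    using component[OF x] component[OF y] by (auto intro: closures)
  have "(\<lambda>j. 2 * (hnorm (K j) (x j))\<^sup>2 + 2 * (hnorm (K j) (y j))\<^sup>2) summable_on J"
    using x y by (intro summable_on_add summable_on_cmult_right) (auto simp: carrier_iff)
  then show "(\<lambda>j. (hnorm (K j) ((\<lambda>j\<in>J. x j \<oplus>\<^bsub>K j\<^esub> y j) j))\<^sup>2) summable_on J"
  proof (rule summable_on_comparison_test)
    fix j assume j: "j \<in> J"
    interpret complex_inner_product_space "K j" by (rule ips) fact
    note c = component[OF x j] component[OF y j]
    have "(hnorm (K j) (x j \<oplus>\<^bsub>K j\<^esub> y j))\<^sup>2 \<le> (hnorm (K j) (x j) + hnorm (K j) (y j))\<^sup>2"
      using c by (intro power_mono hnorm_triangle) auto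
    also have "\<dots> \<le> 2 * (hnorm (K j) (x j))\<^sup>2 + 2 * (hnorm (K j) (y j))\<^sup>2"
      using zero_le_power2[of "hnorm (K j) (x j) - hnorm (K j) (y j)"]
      by (simp add: power2_sum power2_diff)
    finally show "(hnorm (K j) ((\<lambda>j\<in>J. x j \<oplus>\<^bsub>K j\<^esub> y j) j))\<^sup>2
        \<le> 2 * (hnorm (K j) (x j))\<^sup>2 + 2 * (hnorm (K j) (y j))\<^sup>2"
      using j by simp
  qed auto
qed

lemma smult_in:
  assumes x: "x \<in> carrier S"
  shows "(\<lambda>j\<in>J. a \<odot>\<^bsub>K j\<^esub> x j) \<in> carrier S"
  unfolding carrier_iff
proof
  show "(\<lambda>j\<in>J. a \<odot>\<^bsub>K j\<^esub> x j) \<in> (\<Pi>\<^sub>E j\<in>J. carrier (K j))"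
    using component[OF x] by (auto intro: closures)
  have "(\<lambda>j. (cmod a)\<^sup>2 * (hnorm (K j) (x j))\<^sup>2) summable_on J"
    using x by (intro summable_on_cmult_right) (auto simp: carrier_iff)
  then show "(\<lambda>j. (hnorm (K j) ((\<lambda>j\<in>J. a \<odot>\<^bsub>K j\<^esub> x j) j))\<^sup>2) summable_on J"
    by (rule summable_on_cong[THEN iffD1, rotated])
      (simp add: complex_inner_product_space.hnorm_smult[OF ips] component[OF x]
        power_mult_distrib)
qed

lemma cinner_summable:
  assumes x: "x \<in> carrier S" and y: "y \<in> carrier S"
  shows "(\<lambda>j. cinner (K j) (x j) (y j)) summable_on J"
proof (rule abs_summable_summable, rule summable_on_comparison_test)
  show "(\<lambda>j. (hnorm (K j) (x j))\<^sup>2 + (hnorm (K j) (y j))\<^sup>2) summable_on J"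
    using x y by (intro summable_on_add) (auto simp: carrier_iff)
  fix j assume j: "j \<in> J"
  have "cmod (cinner (K j) (x j) (y j)) \<le> hnorm (K j) (x j) * hnorm (K j) (y j)"
    by (intro complex_inner_product_space.cmod_cinner_le[OF ips] component j x y)
  also have "\<dots> \<le> (hnorm (K j) (x j))\<^sup>2 + (hnorm (K j) (y j))\<^sup>2"
    using sum_squares_bound[of "hnorm (K j) (x j)" "hnorm (K j) (y j)"] 
      zero_le_power2[of "hnorm (K j) (x j)"] zero_le_power2[of "hnorm (K j) (y j)"]
    by linarith
  finally show "norm (cinner (K j) (x j) (y j)) \<le> (hnorm (K j) (x j))\<^sup>2 + (hnorm (K j) (y j))\<^sup>2" .
qed auto

lemma sum_module: "module complex_ring S"
proof (rule module_of_separating_maps[where J = J and K = K and p = "\<lambda>j x. x j", OF ips])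
  show "\<zero>\<^bsub>S\<^esub> \<in> carrier S"
    unfolding carrier_iff
  proof
    have "(\<lambda>j. 0::real) summable_on J" by simp
    then show "(\<lambda>j. (hnorm (K j) (\<zero>\<^bsub>S\<^esub> j))\<^sup>2) summable_on J"
      by (rule summable_on_cong[THEN iffD1, rotated])
        (simp add: sum_simps complex_inner_product_space.hnorm_zero[OF ips])
  qed (auto simp: sum_simps zero_closed)
  show "x = y" if "x \<in> carrier S" "y \<in> carrier S" "\<And>j. j \<in> J \<Longrightarrow> x j = y j" for x y
    using that by (auto simp: carrier_iff intro: PiE_ext)
qed (auto simp: sum_simps add_in smult_in component)

lemma sum_ips: "complex_inner_product_space S"
proof (intro complex_inner_product_space.intro sum_module complex_inner_product_space_axioms.intro)
  note ips_simps = complex_inner_product_space.cinner_simps[OF ips]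
  fix x y assume x: "x \<in> carrier S" and y: "y \<in> carrier S"
  show "cinner S (x \<oplus>\<^bsub>S\<^esub> y) z = cinner S x z + cinner S y z" if z: "z \<in> carrier S" for z
    using infsum_add[OF cinner_summable[OF x z] cinner_summable[OF y z]]
    by (simp add: sum_simps ips_simps component x y z cong: infsum_cong)
  show "cinner S (a \<odot>\<^bsub>S\<^esub> x) y = a * cinner S x y" for a
    using infsum_cmult_right[OF cinner_summable[OF x y], of a]
    by (simp add: sum_simps ips_simps component x y cong: infsum_cong)
  have "cinner (K j) (x j) (y j) = cnj (cinner (K j) (y j) (x j))" if "j \<in> J" for j
    by (intro complex_inner_product_space.cinner_commute[OF ips] that component x y)
  then show "cinner S x y = cnj (cinner S y x)"
    by (simp add: sum_simps flip: infsum_cnj cong: infsum_cong)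
next
  fix x assume x: "x \<in> carrier S" and "x \<noteq> \<zero>\<^bsub>S\<^esub>"
  have "\<exists>j\<in>J. x j \<noteq> \<zero>\<^bsub>K j\<^esub>"
  proof (rule ccontr)
    assume "\<not> ?thesis"
    then have "x = \<zero>\<^bsub>S\<^esub>"
      using x by (intro PiE_ext[of _ J "\<lambda>j. carrier (K j)"]) (auto simp: carrier_iff sum_simps zero_closed)
    with \<open>x \<noteq> \<zero>\<^bsub>S\<^esub>\<close> show False ..
  qed
  then obtain j where j: "j \<in> J" "x j \<noteq> \<zero>\<^bsub>K j\<^esub>" by blast
  have Re: "(\<lambda>j. Re (cinner (K j) (x j) (x j))) summable_on J"
    by (rule summable_on_Re[OF cinner_summable[OF x x]])
  have "0 < Re (cinner (K j) (x j) (x j))"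
    by (intro complex_inner_product_space.cinner_pos[OF ips] component x j)
  also have "\<dots> = (\<Sum>j\<in>{j}. Re (cinner (K j) (x j) (x j)))" by simp
  also have "\<dots> \<le> (\<Sum>\<^sub>\<infinity>j\<in>J. Re (cinner (K j) (x j) (x j)))"
    by (rule finite_sum_le_infsum[OF Re])
      (use j in \<open>auto intro: complex_inner_product_space.cinner_self_nonneg[OF ips] component x\<close>)
  also have "\<dots> = Re (cinner S x x)"
    by (simp add: sum_simps infsum_Re[OF cinner_summable[OF x x]])
  finally show "0 < Re (cinner S x x)" .
qed

sublocale S: complex_inner_product_space S by (rule sum_ips)

lemma hnorm_sum_power2:
  assumes x: "x \<in> carrier S"
  shows "(hnorm S x)\<^sup>2 = (\<Sum>\<^sub>\<infinity>j\<in>J. (hnorm (K j) (x j))\<^sup>2)"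
  using x by (simp add: S.hnorm_power2 sum_simps infsum_Re[OF cinner_summable[OF x x], symmetric]
      complex_inner_product_space.hnorm_power2[OF ips] component cong: infsum_cong)

lemma hnorm_component_le:
  assumes x: "x \<in> carrier S" and j: "j \<in> J"
  shows "hnorm (K j) (x j) \<le> hnorm S x"
proof (rule power2_le_imp_le)
  have "(hnorm (K j) (x j))\<^sup>2 = (\<Sum>j\<in>{j}. (hnorm (K j) (x j))\<^sup>2)" by simp
  also have "\<dots> \<le> (hnorm S x)\<^sup>2"
    unfolding hnorm_sum_power2[OF x]
    by (rule finite_sum_le_infsum) (use x j in \<open>auto simp: carrier_iff\<close>)
  finally show "(hnorm (K j) (x j))\<^sup>2 \<le> (hnorm S x)\<^sup>2" .
qed (use x in simp)

lemma diff_component: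
  assumes "x \<in> carrier S" "y \<in> carrier S" "j \<in> J"
  shows "(x \<ominus>\<^bsub>S\<^esub> y) j = x j \<ominus>\<^bsub>K j\<^esub> y j"
  using assms by (simp add: S.diff_eq_smult sum_simps component
      complex_inner_product_space.diff_eq_smult[OF ips])

text \<open>
  The components of a Cauchy sequence converge, and the bounds on its finite partial sums of squares
  pass to the limit; so the componentwise limit is in the sum and is the limit in norm.
\<close>

theorem hilbert_sum_hilbert_space: "hilbert_space S"
proof (rule S.hilbert_spaceI)
  fix \<sigma> :: "nat \<Rightarrow> 'j \<Rightarrow> 'k" assume \<sigma>: "\<And>n. \<sigma> n \<in> carrier S"
    and cauchy: "\<And>e. e > 0 \<Longrightarrow> \<exists>N. \<forall>m\<ge>N. \<forall>n\<ge>N. hnorm S (\<sigma> m \<ominus>\<^bsub>S\<^esub> \<sigma> n) < e"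
  have "\<exists>l. l \<in> carrier (K j) \<and> (\<lambda>n. hnorm (K j) (\<sigma> n j \<ominus>\<^bsub>K j\<^esub> l)) \<longlonglongrightarrow> 0" if j: "j \<in> J" for j
  proof -
    have "\<exists>N. \<forall>m\<ge>N. \<forall>n\<ge>N. hnorm (K j) (\<sigma> m j \<ominus>\<^bsub>K j\<^esub> \<sigma> n j) < e" if "e > 0" for e
    proof -
      have "hnorm (K j) (\<sigma> m j \<ominus>\<^bsub>K j\<^esub> \<sigma> n j) \<le> hnorm S (\<sigma> m \<ominus>\<^bsub>S\<^esub> \<sigma> n)" for m n
        using hnorm_component_le[of "\<sigma> m \<ominus>\<^bsub>S\<^esub> \<sigma> n" j] j by (simp add: diff_component \<sigma>)
      then show ?thesis using cauchy[OF that] by (meson order_le_less_trans)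
    qed
    then show ?thesis
      using hilbert_space.cauchy_limit[OF hilbert[OF j], of "\<lambda>n. \<sigma> n j"] component[OF \<sigma> j] by metis
  qed
  then obtain l' where l': "\<And>j. j \<in> J \<Longrightarrow> l' j \<in> carrier (K j)"
    "\<And>j. j \<in> J \<Longrightarrow> (\<lambda>n. hnorm (K j) (\<sigma> n j \<ominus>\<^bsub>K j\<^esub> l' j)) \<longlonglongrightarrow> 0"
    by metis
  define l where "l = restrict l' J"
  have l: "l \<in> (\<Pi>\<^sub>E j\<in>J. carrier (K j))" "\<And>j. j \<in> J \<Longrightarrow> l j \<in> carrier (K j)"
    "\<And>j. j \<in> J \<Longrightarrow> (\<lambda>n. hnorm (K j) (\<sigma> n j \<ominus>\<^bsub>K j\<^esub> l j)) \<longlonglongrightarrow> 0"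
    using l' by (auto simp: l_def)
  have tail: "\<exists>N. \<forall>n\<ge>N. \<forall>F. finite F \<longrightarrow> F \<subseteq> J \<longrightarrow> (\<Sum>j\<in>F. (hnorm (K j) (\<sigma> n j \<ominus>\<^bsub>K j\<^esub> l j))\<^sup>2) \<le> e\<^sup>2"
    if "e > 0" for e
  proof -
    obtain N where N: "\<And>m n. m \<ge> N \<Longrightarrow> n \<ge> N \<Longrightarrow> hnorm S (\<sigma> n \<ominus>\<^bsub>S\<^esub> \<sigma> m) < e"
      using cauchy[OF \<open>e > 0\<close>] by blast
    have "(\<Sum>j\<in>F. (hnorm (K j) (\<sigma> n j \<ominus>\<^bsub>K j\<^esub> l j))\<^sup>2) \<le> e\<^sup>2"
      if n: "n \<ge> N" and F: "finite F" "F \<subseteq> J" for n F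
    proof (rule LIMSEQ_le_const2)
      show "(\<lambda>m. \<Sum>j\<in>F. (hnorm (K j) (\<sigma> n j \<ominus>\<^bsub>K j\<^esub> \<sigma> m j))\<^sup>2)
          \<longlonglongrightarrow> (\<Sum>j\<in>F. (hnorm (K j) (\<sigma> n j \<ominus>\<^bsub>K j\<^esub> l j))\<^sup>2)"
      proof (intro tendsto_sum tendsto_power)
        fix j assume "j \<in> F"
        then have j: "j \<in> J" using F by auto
        interpret complex_inner_product_space "K j" by (rule ips) fact
        note c = component[OF \<sigma> j] l(2)[OF j]
        have tri: "\<bar>hnorm (K j) (\<sigma> n j \<ominus>\<^bsub>K j\<^esub> \<sigma> m j) - hnorm (K j) (\<sigma> n j \<ominus>\<^bsub>K j\<^esub> l j)\<bar>
            \<le> hnorm (K j) (\<sigma> m j \<ominus>\<^bsub>K j\<^esub> l j)" for m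
          using triangle[of "\<sigma> n j" "\<sigma> m j" "l j"] triangle[of "\<sigma> n j" "l j" "\<sigma> m j"]
            commute[of "l j" "\<sigma> m j"] c by (simp add: hdist_eq)
        show "(\<lambda>m. hnorm (K j) (\<sigma> n j \<ominus>\<^bsub>K j\<^esub> \<sigma> m j)) \<longlonglongrightarrow> hnorm (K j) (\<sigma> n j \<ominus>\<^bsub>K j\<^esub> l j)"
          by (rule LIM_zero_cancel, rule Lim_null_comparison[OF _ l(3)[OF j]]) (simp add: tri)
      qed
      show "\<exists>M. \<forall>m\<ge>M. (\<Sum>j\<in>F. (hnorm (K j) (\<sigma> n j \<ominus>\<^bsub>K j\<^esub> \<sigma> m j))\<^sup>2) \<le> e\<^sup>2"
      proof (intro exI strip)
        fix m assume m: "m \<ge> N"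
        have d: "\<sigma> n \<ominus>\<^bsub>S\<^esub> \<sigma> m \<in> carrier S" using \<sigma> by simp
        have "(\<Sum>j\<in>F. (hnorm (K j) (\<sigma> n j \<ominus>\<^bsub>K j\<^esub> \<sigma> m j))\<^sup>2)
            = (\<Sum>j\<in>F. (hnorm (K j) ((\<sigma> n \<ominus>\<^bsub>S\<^esub> \<sigma> m) j))\<^sup>2)"
          using F by (intro sum.cong) (auto simp: diff_component \<sigma>)
        also have "\<dots> \<le> (hnorm S (\<sigma> n \<ominus>\<^bsub>S\<^esub> \<sigma> m))\<^sup>2"
          unfolding hnorm_sum_power2[OF d]
          by (rule finite_sum_le_infsum) (use d F in \<open>auto simp: carrier_iff\<close>)
        also have "\<dots> \<le> e\<^sup>2" using N[OF m n] d by (intro power_mono) auto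
        finally show "(\<Sum>j\<in>F. (hnorm (K j) (\<sigma> n j \<ominus>\<^bsub>K j\<^esub> \<sigma> m j))\<^sup>2) \<le> e\<^sup>2" .
      qed
    qed
    then show ?thesis by blast
  qed
  have diff_in: "(\<lambda>j\<in>J. \<sigma> n j \<ominus>\<^bsub>K j\<^esub> l j) \<in> carrier S"
    if "\<And>F. finite F \<Longrightarrow> F \<subseteq> J \<Longrightarrow> (\<Sum>j\<in>F. (hnorm (K j) (\<sigma> n j \<ominus>\<^bsub>K j\<^esub> l j))\<^sup>2) \<le> C" for n C
    unfolding carrier_iff
  proof
    show "(\<lambda>j\<in>J. \<sigma> n j \<ominus>\<^bsub>K j\<^esub> l j) \<in> (\<Pi>\<^sub>E j\<in>J. carrier (K j))"
      using component[OF \<sigma>] l by (auto intro: closures)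
    have "(\<lambda>j. (hnorm (K j) (\<sigma> n j \<ominus>\<^bsub>K j\<^esub> l j))\<^sup>2) summable_on J"
      by (rule nonneg_bdd_above_summable_on) (use that in \<open>auto intro!: bdd_aboveI2[where M = C]\<close>)
    then show "(\<lambda>j. (hnorm (K j) ((\<lambda>j\<in>J. \<sigma> n j \<ominus>\<^bsub>K j\<^esub> l j) j))\<^sup>2) summable_on J"
      by (rule summable_on_cong[THEN iffD1, rotated]) simp
  qed
  have lS: "l \<in> carrier S"
  proof -
    obtain n where "\<forall>F. finite F \<longrightarrow> F \<subseteq> J \<longrightarrow> (\<Sum>j\<in>F. (hnorm (K j) (\<sigma> n j \<ominus>\<^bsub>K j\<^esub> l j))\<^sup>2) \<le> 1\<^sup>2"
      using tail[of 1] by auto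
    then have n: "(\<lambda>j\<in>J. \<sigma> n j \<ominus>\<^bsub>K j\<^esub> l j) \<in> carrier S"
      by (intro diff_in) blast
    have "\<sigma> n \<ominus>\<^bsub>S\<^esub> (\<lambda>j\<in>J. \<sigma> n j \<ominus>\<^bsub>K j\<^esub> l j) = l"
    proof (rule PiE_ext)
      show "\<sigma> n \<ominus>\<^bsub>S\<^esub> (\<lambda>j\<in>J. \<sigma> n j \<ominus>\<^bsub>K j\<^esub> l j) \<in> (\<Pi>\<^sub>E j\<in>J. carrier (K j))"
        using S.minus_closed[OF \<sigma> n] by (simp add: carrier_iff)
      fix j assume j: "j \<in> J"
      interpret complex_inner_product_space "K j" by (rule ips) fact
      show "(\<sigma> n \<ominus>\<^bsub>S\<^esub> (\<lambda>j\<in>J. \<sigma> n j \<ominus>\<^bsub>K j\<^esub> l j)) j = l j"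
        using j component[OF \<sigma> j] l(2)[OF j]
        by (intro vector_eqI) (auto simp: diff_component \<sigma> n cinner_simps)
    qed (rule l)
    then show ?thesis using S.minus_closed[OF \<sigma>[of n] n] by simp
  qed
  have "(\<lambda>n. hnorm S (\<sigma> n \<ominus>\<^bsub>S\<^esub> l)) \<longlonglongrightarrow> 0"
  proof (rule LIMSEQ_I)
    fix e :: real assume "e > 0"
    then have "e/2 > 0" by simp
    from tail[OF this] obtain N where N: "\<And>n F. n \<ge> N \<Longrightarrow> finite F \<Longrightarrow> F \<subseteq> J \<Longrightarrow>
        (\<Sum>j\<in>F. (hnorm (K j) (\<sigma> n j \<ominus>\<^bsub>K j\<^esub> l j))\<^sup>2) \<le> (e/2)\<^sup>2"
      by blast
    have "norm (hnorm S (\<sigma> n \<ominus>\<^bsub>S\<^esub> l) - 0) < e" if n: "n \<ge> N" for n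
    proof -
      have d: "\<sigma> n \<ominus>\<^bsub>S\<^esub> l \<in> carrier S" using \<sigma> lS by simp
      have "(hnorm S (\<sigma> n \<ominus>\<^bsub>S\<^esub> l))\<^sup>2 \<le> (e/2)\<^sup>2"
        unfolding hnorm_sum_power2[OF d]
      proof (rule infsum_le_finite_sums)
        fix F assume F: "finite F" "F \<subseteq> J"
        have "(\<Sum>j\<in>F. (hnorm (K j) ((\<sigma> n \<ominus>\<^bsub>S\<^esub> l) j))\<^sup>2)
            = (\<Sum>j\<in>F. (hnorm (K j) (\<sigma> n j \<ominus>\<^bsub>K j\<^esub> l j))\<^sup>2)"
          using F by (intro sum.cong) (auto simp: diff_component \<sigma> lS)
        then show "(\<Sum>j\<in>F. (hnorm (K j) ((\<sigma> n \<ominus>\<^bsub>S\<^esub> l) j))\<^sup>2) \<le> (e/2)\<^sup>2"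
          using N[OF n F] by simp
      qed (use d in \<open>simp add: carrier_iff\<close>)
      then have "hnorm S (\<sigma> n \<ominus>\<^bsub>S\<^esub> l) \<le> e/2"
        by (rule power2_le_imp_le) (use \<open>e > 0\<close> in simp)
      then show ?thesis using \<open>e > 0\<close> d by simp
    qed
    then show "\<exists>N. \<forall>n\<ge>N. norm (hnorm S (\<sigma> n \<ominus>\<^bsub>S\<^esub> l) - 0) < e" by blast
  qed
  with lS show "\<exists>l\<in>carrier S. (\<lambda>n. hnorm S (\<sigma> n \<ominus>\<^bsub>S\<^esub> l)) \<longlonglongrightarrow> 0" by blast
qed

lemma sum_inclusion_in:
  assumes j: "j \<in> J" and u: "u \<in> carrier (K j)"
  shows "sum_inclusion J K j u \<in> carrier S"
  unfolding carrier_iff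
proof
  show "sum_inclusion J K j u \<in> (\<Pi>\<^sub>E j\<in>J. carrier (K j))"
    using u by (auto simp: sum_inclusion_def zero_closed)
  have "(\<lambda>k. (hnorm (K k) (sum_inclusion J K j u k))\<^sup>2) summable_on {j}" by simp
  then show "(\<lambda>k. (hnorm (K k) (sum_inclusion J K j u k))\<^sup>2) summable_on J"
    by (rule summable_on_cong_neutral[THEN iffD1, rotated -1])
      (use j in \<open>auto simp: sum_inclusion_def complex_inner_product_space.hnorm_zero[OF ips]\<close>)
qed

lemma cinner_sum_inclusion:
  assumes j: "j \<in> J" and u: "u \<in> carrier (K j)" and x: "x \<in> carrier S"
  shows "cinner S (sum_inclusion J K j u) x = cinner (K j) u (x j)"
proof -
  have "cinner S (sum_inclusion J K j u) x
      = (\<Sum>\<^sub>\<infinity>k\<in>{j}. cinner (K k) (sum_inclusion J K j u k) (x k))"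
    unfolding sum_simps
    by (rule infsum_cong_neutral) (use j x in \<open>auto simp: sum_inclusion_def component
        complex_inner_product_space.cinner_zero_left[OF ips]\<close>)
  then show ?thesis using j by (simp add: sum_inclusion_def)
qed

lemma sum_inclusion_isometry:
  assumes j: "j \<in> J"
  shows "linear_isometry (K j) S (sum_inclusion J K j)"
proof (rule linear_isometryI[OF ips[OF j] sum_ips])
  interpret Kj: complex_inner_product_space "K j" by (rule ips) fact
  show "linear_operator (K j) S (sum_inclusion J K j)"
    unfolding linear_operator_def
    by (auto intro!: S.vector_eqI
        simp: sum_inclusion_in cinner_sum_inclusion j Kj.cinner_simps S.cinner_simps component)
  show "cinner S (sum_inclusion J K j x) (sum_inclusion J K j x) = cinner (K j) x x"
    if "x \<in> carrier (K j)" for x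
    using that j by (simp add: cinner_sum_inclusion sum_inclusion_in) (simp add: sum_inclusion_def)
qed

lemma sum_inclusion_orthogonal:
  assumes "i \<in> J" "j \<in> J" "i \<noteq> j" "u \<in> carrier (K i)" "v \<in> carrier (K j)"
  shows "cinner S (sum_inclusion J K i u) (sum_inclusion J K j v) = 0"
  using assms by (simp add: cinner_sum_inclusion sum_inclusion_in)
    (simp add: sum_inclusion_def complex_inner_product_space.cinner_zero_right[OF ips])

end

section \<open>Subspaces and isomorphic copies\<close>

definition orthogonal_complement :: "'h inner_product_module \<Rightarrow> 'h set \<Rightarrow> 'h set" where
  "orthogonal_complement H A = {v \<in> carrier H. \<forall>w\<in>A. cinner H v w = 0}"

text \<open>
  Inner products are linear and continuous, so the complement is a closed subspace.
\<close>

lemma orthogonal_complement_hilbert_space: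
  assumes "hilbert_space H" and A: "A \<subseteq> carrier H"
  shows "hilbert_space (H\<lparr>carrier := orthogonal_complement H A\<rparr>)"
proof -
  interpret H: hilbert_space H by fact
  let ?C = "orthogonal_complement H A"
  let ?S = "H\<lparr>carrier := ?C\<rparr>"
  have CD: "v \<in> carrier H" if "v \<in> ?C" for v using that by (simp add: orthogonal_complement_def)
  note closed = H.smult_closed' H.M.a_closed H.M.zero_closed
  interpret S: complex_inner_product_space ?S
  proof (intro complex_inner_product_space.intro complex_inner_product_space_axioms.intro)
    show "module complex_ring ?S"
      by (rule module_of_separating_maps[where J = "UNIV :: unit set" and K = "\<lambda>_. H" and p = "\<lambda>_ x. x"])
        (use A in \<open>auto simp: orthogonal_complement_def closed H.cinner_simps subset_iff
          intro: H.complex_inner_product_space_axioms\<close>)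
  qed (auto simp: CD H.cinner_simps H.cinner_pos intro: H.cinner_commute CD)
  have diff: "v \<ominus>\<^bsub>?S\<^esub> w = v \<ominus>\<^bsub>H\<^esub> w" if "v \<in> ?C" "w \<in> ?C" for v w
    using that CD by (simp add: S.diff_eq_smult H.diff_eq_smult)
  have norm: "hnorm ?S = hnorm H" by (simp add: hnorm_def fun_eq_iff)
  show ?thesis
  proof (rule S.hilbert_spaceI)
    fix \<sigma> :: "nat \<Rightarrow> 'a" assume "\<And>n. \<sigma> n \<in> carrier ?S"
    then have \<sigma>: "\<And>n. \<sigma> n \<in> ?C" by simp
    assume "\<And>e. e > 0 \<Longrightarrow> \<exists>N. \<forall>m\<ge>N. \<forall>n\<ge>N. hnorm ?S (\<sigma> m \<ominus>\<^bsub>?S\<^esub> \<sigma> n) < e"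
    then have "\<And>e. e > 0 \<Longrightarrow> \<exists>N. \<forall>m\<ge>N. \<forall>n\<ge>N. hnorm H (\<sigma> m \<ominus>\<^bsub>H\<^esub> \<sigma> n) < e"
      by (simp add: diff \<sigma> norm)
    then obtain l where l: "l \<in> carrier H" "(\<lambda>n. hnorm H (\<sigma> n \<ominus>\<^bsub>H\<^esub> l)) \<longlonglongrightarrow> 0"
      using H.cauchy_limit[of \<sigma>] CD[OF \<sigma>] by metis
    have "cinner H l w = 0" if w: "w \<in> A" for w
    proof (rule LIMSEQ_unique)
      show "(\<lambda>n. cinner H (\<sigma> n) w) \<longlonglongrightarrow> cinner H l w"
        using w A by (intro H.cinner_limit l CD[OF \<sigma>]) auto
      show "(\<lambda>n. cinner H (\<sigma> n) w) \<longlonglongrightarrow> 0"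
        using \<sigma> w by (simp add: orthogonal_complement_def)
    qed
    then have "l \<in> ?C" using l by (simp add: orthogonal_complement_def)
    then show "\<exists>l\<in>carrier ?S. (\<lambda>n. hnorm ?S (\<sigma> n \<ominus>\<^bsub>?S\<^esub> l)) \<longlonglongrightarrow> 0"
      using l by (intro bexI[of _ l]) (simp_all add: diff \<sigma> norm)
  qed
qed

definition transported_space ::
  "'h inner_product_module \<Rightarrow> ('h \<Rightarrow> 'k) \<Rightarrow> 'k inner_product_module" where
  "transported_space H f = (let g = inv_into (carrier H) f in
    \<lparr>carrier = f ` carrier H, mult = undefined, one = undefined, zero = f \<zero>\<^bsub>H\<^esub>,
     add = (\<lambda>x y. f (g x \<oplus>\<^bsub>H\<^esub> g y)), smult = (\<lambda>a x. f (a \<odot>\<^bsub>H\<^esub> g x)),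
     cinner = (\<lambda>x y. cinner H (g x) (g y))\<rparr>)"

lemma transported_space:
  assumes "hilbert_space H" and inj: "inj_on f (carrier H)"
  shows "hilbert_space (transported_space H f)"
    and "linear_isometry (transported_space H f) H (inv_into (carrier H) f)"
    and "carrier (transported_space H f) = f ` carrier H"
proof -
  interpret H: hilbert_space H by fact
  define g where "g = inv_into (carrier H) f"
  let ?T = "transported_space H f"
  have gf: "g (f x) = x" if "x \<in> carrier H" for x using that inj by (simp add: g_def)
  have T: "carrier ?T = f ` carrier H" "\<zero>\<^bsub>?T\<^esub> = f \<zero>\<^bsub>H\<^esub>" "x \<oplus>\<^bsub>?T\<^esub> y = f (g x \<oplus>\<^bsub>H\<^esub> g y)"
    "a \<odot>\<^bsub>?T\<^esub> x = f (a \<odot>\<^bsub>H\<^esub> g x)" "cinner ?T x y = cinner H (g x) (g y)" for x y a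
    by (simp_all add: transported_space_def g_def Let_def)
  interpret T: complex_inner_product_space ?T
  proof (intro complex_inner_product_space.intro complex_inner_product_space_axioms.intro)
    show "module complex_ring ?T"
      by (rule module_of_separating_maps[where J = "UNIV :: unit set" and K = "\<lambda>_. H" and p = "\<lambda>_. g"])
        (auto simp: T gf intro: H.complex_inner_product_space_axioms)
    show "0 < Re (cinner ?T x x)" if x: "x \<in> carrier ?T" "x \<noteq> \<zero>\<^bsub>?T\<^esub>" for x
    proof -
      obtain v where "v \<in> carrier H" "x = f v" "v \<noteq> \<zero>\<^bsub>H\<^esub>" using x by (auto simp: T)
      then show ?thesis by (simp add: T gf H.cinner_pos)
    qed
  qed (auto simp: T gf H.cinner_simps intro: H.cinner_commute)
  show iso: "linear_isometry ?T H (inv_into (carrier H) f)"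
    unfolding g_def[symmetric]
    by (intro linear_isometryI T.complex_inner_product_space_axioms
        H.complex_inner_product_space_axioms) (auto simp: linear_operator_def T gf)
  have g_diff: "g (x \<ominus>\<^bsub>?T\<^esub> y) = g x \<ominus>\<^bsub>H\<^esub> g y" if "x \<in> carrier ?T" "y \<in> carrier ?T" for x y
    using linear_operator_diff[OF T.complex_inner_product_space_axioms
        H.complex_inner_product_space_axioms linear_isometryD(1)[OF iso] that]
    by (simp add: g_def)
  have norm: "hnorm ?T x = hnorm H (g x)" for x by (simp add: hnorm_def T)
  show "hilbert_space ?T"
  proof (rule T.hilbert_spaceI)
    fix \<sigma> :: "nat \<Rightarrow> 'b" assume \<sigma>: "\<And>n. \<sigma> n \<in> carrier ?T"
    then have g\<sigma>: "g (\<sigma> n) \<in> carrier H" for n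
      using linear_isometryD(3)[OF iso] by (simp add: g_def)
    assume "\<And>e. e > 0 \<Longrightarrow> \<exists>N. \<forall>m\<ge>N. \<forall>n\<ge>N. hnorm ?T (\<sigma> m \<ominus>\<^bsub>?T\<^esub> \<sigma> n) < e"
    then have "\<And>e. e > 0 \<Longrightarrow> \<exists>N. \<forall>m\<ge>N. \<forall>n\<ge>N. hnorm H (g (\<sigma> m) \<ominus>\<^bsub>H\<^esub> g (\<sigma> n)) < e"
      by (simp add: norm g_diff \<sigma>)
    then obtain l where l: "l \<in> carrier H" "(\<lambda>n. hnorm H (g (\<sigma> n) \<ominus>\<^bsub>H\<^esub> l)) \<longlonglongrightarrow> 0"
      using H.cauchy_limit[of "\<lambda>n. g (\<sigma> n)"] g\<sigma> by metis
    have fl: "f l \<in> carrier ?T" using l by (simp add: T)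
    then show "\<exists>l\<in>carrier ?T. (\<lambda>n. hnorm ?T (\<sigma> n \<ominus>\<^bsub>?T\<^esub> l)) \<longlonglongrightarrow> 0"
      using l by (intro bexI[OF _ fl]) (simp add: norm g_diff \<sigma> gf)
  qed
  show "carrier ?T = f ` carrier H" by (rule T)
qed

section \<open>Strong continuity\<close>

text \<open>
  Continuity of operator-valued maps is transferred by comparing increments. The comparison maps
  may depend on the point at which continuity is tested, which is essential for inversion in the
  unitary group; two of them are admitted for the sake of products.
\<close>

lemma continuous_map_dominated:
  assumes "complex_inner_product_space H" "complex_inner_product_space K"
    and \<phi>: "\<And>x. x \<in> topspace X \<Longrightarrow> continuous_map X (Metric_space.mtopology (carrier H) (hdist H)) (\<phi> x)"
    and \<omega>: "\<And>x. x \<in> topspace X \<Longrightarrow> continuous_map X (Metric_space.mtopology (carrier H) (hdist H)) (\<omega> x)"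
    and \<psi>: "\<And>x. x \<in> topspace X \<Longrightarrow> \<psi> x \<in> carrier K"
    and le: "\<And>x y. x \<in> topspace X \<Longrightarrow> y \<in> topspace X \<Longrightarrow>
      hnorm K (\<psi> x \<ominus>\<^bsub>K\<^esub> \<psi> y) \<le> hnorm H (\<phi> x x \<ominus>\<^bsub>H\<^esub> \<phi> x y) + hnorm H (\<omega> x x \<ominus>\<^bsub>H\<^esub> \<omega> x y)"
  shows "continuous_map X (Metric_space.mtopology (carrier K) (hdist K)) \<psi>"
proof -
  interpret H: complex_inner_product_space H by fact
  interpret K: complex_inner_product_space K by fact
  show ?thesis
    unfolding K.continuous_map_to_metric
  proof (intro ballI allI impI)
    fix x and e :: real assume x: "x \<in> topspace X" and e: "e > 0"
    then have "e/2 > 0" by simp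
    with \<phi>[OF x] x obtain U where U: "openin X U" "x \<in> U" "\<forall>y\<in>U. \<phi> x y \<in> H.mball (\<phi> x x) (e/2)"
      unfolding H.continuous_map_to_metric by blast
    from \<open>e/2 > 0\<close> \<omega>[OF x] x
    obtain V where V: "openin X V" "x \<in> V" "\<forall>y\<in>V. \<omega> x y \<in> H.mball (\<omega> x x) (e/2)"
      unfolding H.continuous_map_to_metric by blast
    have "\<psi> y \<in> K.mball (\<psi> x) e" if y: "y \<in> U \<inter> V" for y
    proof -
      have "y \<in> topspace X" using y U(1) openin_subset by fastforce
      moreover have "hdist H (\<phi> x x) (\<phi> x y) < e/2" "\<phi> x x \<in> carrier H" "\<phi> x y \<in> carrier H"
        "hdist H (\<omega> x x) (\<omega> x y) < e/2" "\<omega> x x \<in> carrier H" "\<omega> x y \<in> carrier H"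
        using y U(3) V(3) by auto
      ultimately show ?thesis
        using le[OF x, of y] \<psi> x by (simp add: H.hdist_eq K.hdist_eq)
    qed
    then show "\<exists>U. openin X U \<and> x \<in> U \<and> (\<forall>y\<in>U. \<psi> y \<in> K.mball (\<psi> x) e)"
      using U V by (intro exI[of _ "U \<inter> V"]) auto
  qed
qed

lemma continuous_map_isometric:
  assumes "complex_inner_product_space H" "complex_inner_product_space K"
    and \<phi>: "continuous_map X (Metric_space.mtopology (carrier H) (hdist H)) \<phi>"
    and \<psi>: "\<And>x. x \<in> topspace X \<Longrightarrow> \<psi> x \<in> carrier K"
    and eq: "\<And>x y. x \<in> topspace X \<Longrightarrow> y \<in> topspace X \<Longrightarrow>
      hnorm K (\<psi> x \<ominus>\<^bsub>K\<^esub> \<psi> y) = hnorm H (\<phi> x \<ominus>\<^bsub>H\<^esub> \<phi> y)"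
  shows "continuous_map X (Metric_space.mtopology (carrier K) (hdist K)) \<psi>"
proof (rule continuous_map_dominated[OF assms(1,2), where \<phi> = "\<lambda>_. \<phi>" and \<omega> = "\<lambda>_. \<phi>"])
  interpret H: complex_inner_product_space H by fact
  interpret K: complex_inner_product_space K by fact
  show "hnorm K (\<psi> x \<ominus>\<^bsub>K\<^esub> \<psi> y) \<le> hnorm H (\<phi> x \<ominus>\<^bsub>H\<^esub> \<phi> y) + hnorm H (\<phi> x \<ominus>\<^bsub>H\<^esub> \<phi> y)"
    if "x \<in> topspace X" "y \<in> topspace X" for x y
    using K.hnorm_nonneg[of "\<psi> x \<ominus>\<^bsub>K\<^esub> \<psi> y"] that by (simp add: eq[symmetric] \<psi>)
qed (use \<phi> \<psi> in auto)

section \<open>Unitary representations\<close>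

lemma unitary_representationD:
  assumes "unitary_representation G H U"
  shows "x \<in> carrier G \<Longrightarrow> linear_isometry H H (U x)"
    and "v \<in> carrier H \<Longrightarrow> U \<one>\<^bsub>G\<^esub> v = v"
    and "x \<in> carrier G \<Longrightarrow> y \<in> carrier G \<Longrightarrow> v \<in> carrier H \<Longrightarrow> U (x \<otimes>\<^bsub>G\<^esub> y) v = U x (U y v)"
    and "v \<in> carrier H \<Longrightarrow>
      continuous_map (topol G) (Metric_space.mtopology (carrier H) (hdist H)) (\<lambda>x. U x v)"
    and "x \<in> carrier G \<Longrightarrow> v \<in> carrier H \<Longrightarrow> U x v \<in> carrier H"
  using assms
  by (auto simp: unitary_representation_def unitary_operator_def operator_homomorphism_def
      strongly_continuous_def linear_isometry_def linear_operator_def)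

text \<open>The operators are onto because those of the inverse elements invert them.\<close>

lemma unitary_representationI:
  assumes "group G"
    and iso: "\<And>x. x \<in> carrier G \<Longrightarrow> linear_isometry H H (U x)"
    and one: "\<And>v. v \<in> carrier H \<Longrightarrow> U \<one>\<^bsub>G\<^esub> v = v"
    and mult: "\<And>x y v. x \<in> carrier G \<Longrightarrow> y \<in> carrier G \<Longrightarrow> v \<in> carrier H \<Longrightarrow> U (x \<otimes>\<^bsub>G\<^esub> y) v = U x (U y v)"
    and "\<And>v. v \<in> carrier H \<Longrightarrow>
      continuous_map (topol G) (Metric_space.mtopology (carrier H) (hdist H)) (\<lambda>x. U x v)"
  shows "unitary_representation G H U"
proof -
  interpret G: group G by fact
  have "U x ` carrier H = carrier H" if x: "x \<in> carrier G" for x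
  proof
    show "U x ` carrier H \<subseteq> carrier H" using linear_isometryD(3)[OF iso[OF x]] by auto
    show "carrier H \<subseteq> U x ` carrier H"
    proof
      fix v assume v: "v \<in> carrier H"
      then have "v = U x (U (inv\<^bsub>G\<^esub> x) v)"
        using mult[of x "inv\<^bsub>G\<^esub> x" v] x by (simp add: one)
      then show "v \<in> U x ` carrier H"
        using v x linear_isometryD(3)[OF iso[of "inv\<^bsub>G\<^esub> x"]] by blast
    qed
  qed
  then show ?thesis
    using assms by (simp add: unitary_representation_def unitary_operator_def
        operator_homomorphism_def strongly_continuous_def)
qed

lemma unitary_representation_cinner:
  assumes "group G" "complex_inner_product_space H" and U: "unitary_representation G H U"
    and x: "x \<in> carrier G" and v: "v \<in> carrier H" and w: "w \<in> carrier H"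
  shows "cinner H (U x v) w = cinner H v (U (inv\<^bsub>G\<^esub> x) w)"
proof -
  interpret G: group G by fact
  note U' = unitary_representationD[OF U]
  have "cinner H (U x v) w = cinner H (U (inv\<^bsub>G\<^esub> x) (U x v)) (U (inv\<^bsub>G\<^esub> x) w)"
    by (rule linear_isometry_cinner[symmetric, OF assms(2) assms(2) U'(1)]) (use x v w U' in auto)
  also have "U (inv\<^bsub>G\<^esub> x) (U x v) = v"
    using U'(3)[of "inv\<^bsub>G\<^esub> x" x v] x v by (simp add: U'(2))
  finally show ?thesis .
qed

text \<open>
  This covers at once the restriction to an invariant subspace and the passage to an isomorphic copy
  of it.
\<close>

lemma unitary_representation_pullback:
  assumes "group G" "complex_inner_product_space H" "complex_inner_product_space K"
    and f: "linear_isometry H K f"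
    and U: "unitary_representation G K U"
    and invariant: "\<And>x v. x \<in> carrier G \<Longrightarrow> v \<in> carrier H \<Longrightarrow> U x (f v) \<in> f ` carrier H"
    and top: "topspace (topol G) = carrier G"
  shows "unitary_representation G H (\<lambda>x v. inv_into (carrier H) f (U x (f v)))"
proof -
  interpret G: group G by fact
  interpret H: complex_inner_product_space H by fact
  interpret K: complex_inner_product_space K by fact
  note U' = unitary_representationD[OF U]
  note f_op = linear_isometryD(1)[OF f]
  note f' = linear_isometryD(2)[OF f] linear_operatorD[OF f_op]
  have f_diff: "f (v \<ominus>\<^bsub>H\<^esub> w) = f v \<ominus>\<^bsub>K\<^esub> f w" if "v \<in> carrier H" "w \<in> carrier H" for v w
    using that by (intro linear_operator_diff[OF _ _ f_op]) unfold_locales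
  have inj: "inj_on f (carrier H)"
  proof (rule inj_onI)
    fix v w assume vw: "v \<in> carrier H" "w \<in> carrier H" "f v = f w"
    then have "hnorm H (v \<ominus>\<^bsub>H\<^esub> w) = 0"
      by (simp add: f'(1)[symmetric] f_diff f' K.hnorm_diff_eq_zero
          del: H.hnorm_eq_zero_iff K.hnorm_eq_zero_iff)
    then show "v = w" using vw by (simp add: H.hnorm_diff_eq_zero del: H.hnorm_eq_zero_iff)
  qed
  define V where "V x v = inv_into (carrier H) f (U x (f v))" for x v
  have V: "V x v \<in> carrier H" "f (V x v) = U x (f v)" if "x \<in> carrier G" "v \<in> carrier H" for x v
    using invariant[OF that] unfolding V_def by (auto simp: inv_into_into f_inv_into_f)
  have eqI: "v = w" if "f v = f w" "v \<in> carrier H" "w \<in> carrier H" for v w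
    using inj that by (auto dest: inj_onD)
  have "unitary_representation G H V"
  proof (rule unitary_representationI[OF \<open>group G\<close>])
    show "linear_isometry H H (V x)" if x: "x \<in> carrier G" for x
      unfolding linear_isometry_def linear_operator_def
    proof (intro conjI ballI allI)
      fix v assume v: "v \<in> carrier H"
      note Ux = linear_isometryD(2)[OF U'(1)[OF x]] linear_operatorD[OF linear_isometryD(1)[OF U'(1)[OF x]]]
      show "hnorm H (V x v) = hnorm H v"
        using v x by (simp add: f'(1)[symmetric] V Ux f'(2))
      show "V x (v \<oplus>\<^bsub>H\<^esub> w) = V x v \<oplus>\<^bsub>H\<^esub> V x w" if "w \<in> carrier H" for w
        by (rule eqI) (use v x that in \<open>auto simp: V f' Ux\<close>)
      show "V x (a \<odot>\<^bsub>H\<^esub> v) = a \<odot>\<^bsub>H\<^esub> V x v" for a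
        by (rule eqI) (use v x in \<open>auto simp: V f' Ux\<close>)
    qed (use V x in auto)
    show "V (x \<otimes>\<^bsub>G\<^esub> y) v = V x (V y v)" if "x \<in> carrier G" "y \<in> carrier G" "v \<in> carrier H" for x y v
      by (rule eqI) (use that in \<open>auto simp: V U' f'\<close>)
    show "V \<one>\<^bsub>G\<^esub> v = v" if "v \<in> carrier H" for v
      by (rule eqI) (use that in \<open>auto simp: V U' f'\<close>)
    show "continuous_map (topol G) H.mtopology (\<lambda>x. V x v)" if v: "v \<in> carrier H" for v
    proof (rule continuous_map_isometric[OF \<open>complex_inner_product_space K\<close> _ U'(4)])
      show "f v \<in> carrier K" using v f' by simp
      show "hnorm H (V x v \<ominus>\<^bsub>H\<^esub> V y v) = hnorm K (U x (f v) \<ominus>\<^bsub>K\<^esub> U y (f v))"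
        if "x \<in> topspace (topol G)" "y \<in> topspace (topol G)" for x y
        using that v by (simp add: f'(1)[symmetric] V f_diff top)
    qed (use V v top in \<open>auto intro: H.complex_inner_product_space_axioms\<close>)
  qed
  then show ?thesis by (simp add: V_def[abs_def])
qed

section \<open>The unitary group\<close>

text \<open>
  Unitary operators are represented by functions that are undefined outside the space, so that
  the group operations are determined by what the operators do. The product topology on functions
  is pointwise convergence, hence restricts to the strong operator topology.
\<close>

definition unitary_group :: "'h inner_product_module \<Rightarrow> ('h \<Rightarrow> 'h) top_monoid" where
  "unitary_group H =
    \<lparr>carrier = {u \<in> extensional (carrier H). unitary_operator H u},
     mult = compose (carrier H), one = (\<lambda>v\<in>carrier H. v),
     topol = subtopology
       (product_topology (\<lambda>_. Metric_space.mtopology (carrier H) (hdist H)) (carrier H))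
       {u \<in> extensional (carrier H). unitary_operator H u}\<rparr>"

lemma unitary_group_simps:
  "carrier (unitary_group H) = {u \<in> extensional (carrier H). unitary_operator H u}"
  "u \<otimes>\<^bsub>unitary_group H\<^esub> v = compose (carrier H) u v"
  "\<one>\<^bsub>unitary_group H\<^esub> = (\<lambda>v\<in>carrier H. v)"
  "topol (unitary_group H) = subtopology
       (product_topology (\<lambda>_. Metric_space.mtopology (carrier H) (hdist H)) (carrier H))
       (carrier (unitary_group H))"
  by (simp_all add: unitary_group_def)

lemma unitary_groupD:
  assumes "u \<in> carrier (unitary_group H)"
  shows "u \<in> extensional (carrier H)" "linear_isometry H H u" "u ` carrier H = carrier H"
    "v \<in> carrier H \<Longrightarrow> u v \<in> carrier H"
  using assms by (auto simp: unitary_group_simps unitary_operator_def linear_isometry_def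
      linear_operator_def)

context complex_inner_product_space
begin

lemma continuous_map_into_unitary_group:
  "continuous_map X (topol (unitary_group H)) F \<longleftrightarrow>
    (\<forall>x\<in>topspace X. F x \<in> carrier (unitary_group H)) \<and>
    (\<forall>v\<in>carrier H. continuous_map X mtopology (\<lambda>x. F x v))"
  unfolding unitary_group_simps(4) continuous_map_in_subtopology continuous_map_componentwise
  by (auto simp: unitary_group_simps(1))

lemma topspace_unitary_group: "topspace (topol (unitary_group H)) = carrier (unitary_group H)"
proof -
  have "carrier (unitary_group H) \<subseteq> (\<Pi>\<^sub>E v\<in>carrier H. carrier H)"
    using unitary_groupD(1,4)[of _ H] by (blast intro: PiE_I dest: extensional_arb)
  then show ?thesis by (simp add: unitary_group_simps(4) Int_absorb1)
qed

lemma unitary_group_group: "group (unitary_group H)"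
proof (rule groupI)
  let ?G = "unitary_group H"
  show one: "\<one>\<^bsub>?G\<^esub> \<in> carrier ?G"
    by (auto simp: unitary_group_simps unitary_operator_def linear_isometry_def linear_operator_def)
  fix u assume u: "u \<in> carrier ?G"
  note u' = unitary_groupD[OF u]
  note u_lin = linear_isometryD[OF u'(2)] linear_operatorD[OF linear_isometryD(1)[OF u'(2)]]
  show "\<one>\<^bsub>?G\<^esub> \<otimes>\<^bsub>?G\<^esub> u = u"
    using u' by (intro extensionalityI[of _ "carrier H"]) (auto simp: unitary_group_simps compose_def)
  show "u \<otimes>\<^bsub>?G\<^esub> v \<in> carrier ?G" if v: "v \<in> carrier ?G" for v
  proof -
    note v' = unitary_groupD[OF v]
    note v_lin = linear_isometryD[OF v'(2)] linear_operatorD[OF linear_isometryD(1)[OF v'(2)]]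
    have "compose (carrier H) u v ` carrier H = u ` v ` carrier H"
      by (simp add: compose_def image_image)
    then have "compose (carrier H) u v ` carrier H = carrier H" by (simp add: u'(3) v'(3))
    then show ?thesis
      using u_lin v_lin by (auto simp: unitary_group_simps unitary_operator_def
          linear_isometry_def linear_operator_def compose_def)
  qed
  show "u \<otimes>\<^bsub>?G\<^esub> v \<otimes>\<^bsub>?G\<^esub> w = u \<otimes>\<^bsub>?G\<^esub> (v \<otimes>\<^bsub>?G\<^esub> w)"
    if "v \<in> carrier ?G" "w \<in> carrier ?G" for v w
    using unitary_groupD(4)[OF that(2)]
    by (auto simp: unitary_group_simps compose_def fun_eq_iff)
  define v where "v = restrict (inv_into (carrier H) u) (carrier H)"
  have v: "v x \<in> carrier H" "u (v x) = x" if "x \<in> carrier H" for x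
    using that u'(3) by (auto simp: v_def inv_into_into f_inv_into_f)
  have inj: "x = y" if xy: "u x = u y" "x \<in> carrier H" "y \<in> carrier H" for x y
  proof -
    have "cinner H x z = cinner H y z" if "z \<in> carrier H" for z
      using linear_isometry_cinner[OF _ _ u'(2), of _ z] xy that
      by (metis complex_inner_product_space_axioms)
    then show ?thesis using xy vector_eqI by blast
  qed
  have vu: "v (u x) = x" if "x \<in> carrier H" for x
    by (rule inj) (use that v u_lin in auto)
  have "v ` carrier H = carrier H"
  proof
    show "carrier H \<subseteq> v ` carrier H"
    proof
      fix x assume x: "x \<in> carrier H"
      show "x \<in> v ` carrier H"
        by (rule image_eqI[of _ _ "u x"]) (use x vu u'(4) in auto)
    qed
  qed (use v(1) in auto)
  moreover have "linear_operator H H v"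
    unfolding linear_operator_def
  proof (intro conjI ballI allI)
    fix x assume x: "x \<in> carrier H"
    show "v (x \<oplus>\<^bsub>H\<^esub> y) = v x \<oplus>\<^bsub>H\<^esub> v y" if y: "y \<in> carrier H" for y
      by (rule inj) (simp_all add: v x y u_lin(5))
    show "v (a \<odot>\<^bsub>H\<^esub> x) = a \<odot>\<^bsub>H\<^esub> v x" for a
      by (rule inj) (simp_all add: v x u_lin(6))
  qed (rule v)
  moreover have "hnorm H (v x) = hnorm H x" if "x \<in> carrier H" for x
    using u_lin(2)[OF v(1)[OF that]] v(2)[OF that] by simp
  ultimately have "v \<in> carrier ?G"
    by (simp add: unitary_group_simps unitary_operator_def linear_isometry_def v_def)
  moreover have "v \<otimes>\<^bsub>?G\<^esub> u = \<one>\<^bsub>?G\<^esub>"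
    by (auto simp: unitary_group_simps compose_def vu)
  ultimately show "\<exists>v\<in>carrier ?G. v \<otimes>\<^bsub>?G\<^esub> u = \<one>\<^bsub>?G\<^esub>" by blast
qed

text \<open>
  Multiplication is jointly continuous since the operators are isometries:
  \<open>\<parallel>u (v \<xi>) - u' (v' \<xi>)\<parallel> \<le> \<parallel>u (v \<xi>) - u' (v \<xi>)\<parallel> + \<parallel>v \<xi> - v' \<xi>\<parallel>\<close>. Inversion is continuous since
  \<open>\<parallel>u\<^sup>-\<^sup>1 \<xi> - u'\<^sup>-\<^sup>1 \<xi>\<parallel> = \<parallel>u' \<eta> - u \<eta>\<parallel>\<close> for \<open>\<eta> = u\<^sup>-\<^sup>1 \<xi>\<close>.
\<close>

theorem unitary_group_topological_group: "topological_group (unitary_group H)"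
proof (intro topological_group.intro topological_group_axioms.intro unitary_group_group
    topspace_unitary_group)
  let ?G = "unitary_group H" and ?T = "topol (unitary_group H)"
  interpret G: group ?G by (rule unitary_group_group)
  note ips = complex_inner_product_space_axioms
  have eval: "continuous_map ?T mtopology (\<lambda>u. u v)" if "v \<in> carrier H" for v
    using continuous_map_into_unitary_group[of ?T "\<lambda>u. u"] that by simp
  have iso: "hnorm H (u v \<ominus>\<^bsub>H\<^esub> u w) = hnorm H (v \<ominus>\<^bsub>H\<^esub> w)"
    if u: "u \<in> carrier ?G" and vw: "v \<in> carrier H" "w \<in> carrier H" for u v w
    using linear_isometryD(2)[OF unitary_groupD(2)[OF u], of "v \<ominus>\<^bsub>H\<^esub> w"] vw
      linear_operator_diff[OF ips ips linear_isometryD(1)[OF unitary_groupD(2)[OF u]]] by simp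
  show "continuous_map (prod_topology ?T ?T) ?T (\<lambda>(u, v). u \<otimes>\<^bsub>?G\<^esub> v)"
    unfolding continuous_map_into_unitary_group
  proof (intro conjI ballI)
    fix \<xi> assume \<xi>: "\<xi> \<in> carrier H"
    show "continuous_map (prod_topology ?T ?T) mtopology (\<lambda>p. (case p of (u, v) \<Rightarrow> u \<otimes>\<^bsub>?G\<^esub> v) \<xi>)"
    proof (rule continuous_map_dominated[OF ips ips,
          where \<phi> = "\<lambda>p q. fst q (snd p \<xi>)" and \<omega> = "\<lambda>p q. snd q \<xi>"])
      fix p assume p: "p \<in> topspace (prod_topology ?T ?T)"
      then have p': "fst p \<in> carrier ?G" "snd p \<in> carrier ?G"
        by (auto simp: topspace_unitary_group)
      show "continuous_map (prod_topology ?T ?T) mtopology (\<lambda>q. fst q (snd p \<xi>))"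
        using continuous_map_compose[OF continuous_map_fst eval, of "snd p \<xi>" ?T]
          unitary_groupD(4)[OF p'(2) \<xi>] by (simp add: o_def)
      show "continuous_map (prod_topology ?T ?T) mtopology (\<lambda>q. snd q \<xi>)"
        using continuous_map_compose[OF continuous_map_snd eval, of \<xi> ?T] \<xi> by (simp add: o_def)
      show "(case p of (u, v) \<Rightarrow> u \<otimes>\<^bsub>?G\<^esub> v) \<xi> \<in> carrier H"
        using unitary_groupD(4)[OF p'(1)] unitary_groupD(4)[OF p'(2)] \<xi>
        by (cases p) (simp add: unitary_group_simps compose_def)
      fix q assume "q \<in> topspace (prod_topology ?T ?T)"
      then have q': "fst q \<in> carrier ?G" "snd q \<in> carrier ?G"
        by (auto simp: topspace_unitary_group)
      obtain u v where uv: "p = (u, v)" by (cases p)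
      obtain u' v' where uv': "q = (u', v')" by (cases q)
      note mem = p' q' unitary_groupD(4)[OF p'(1)] unitary_groupD(4)[OF p'(2)]
        unitary_groupD(4)[OF q'(1)] unitary_groupD(4)[OF q'(2)]
      have "hdist H (u (v \<xi>)) (u' (v' \<xi>)) \<le> hdist H (u (v \<xi>)) (u' (v \<xi>)) + hdist H (u' (v \<xi>)) (u' (v' \<xi>))"
        using mem uv uv' \<xi> by (intro triangle) auto
      then show "hnorm H ((case p of (u, v) \<Rightarrow> u \<otimes>\<^bsub>?G\<^esub> v) \<xi> \<ominus>\<^bsub>H\<^esub> (case q of (u, v) \<Rightarrow> u \<otimes>\<^bsub>?G\<^esub> v) \<xi>)
          \<le> hnorm H (fst p (snd p \<xi>) \<ominus>\<^bsub>H\<^esub> fst q (snd p \<xi>)) + hnorm H (snd p \<xi> \<ominus>\<^bsub>H\<^esub> snd q \<xi>)"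
        using mem uv uv' \<xi> iso[of u' "v \<xi>" "v' \<xi>"]
        by (simp add: unitary_group_simps(2) compose_def hdist_eq)
    qed
  qed (auto simp: topspace_unitary_group)
  have inv1: "u ((inv\<^bsub>?G\<^esub> u) v) = v" if "u \<in> carrier ?G" "v \<in> carrier H" for u v
    using fun_cong[OF G.r_inv[OF that(1)], of v] that
    by (simp add: unitary_group_simps(2,3) compose_def)
  show "continuous_map ?T ?T (\<lambda>u. inv\<^bsub>?G\<^esub> u)"
    unfolding continuous_map_into_unitary_group
  proof (intro conjI ballI)
    fix \<xi> assume \<xi>: "\<xi> \<in> carrier H"
    have mem: "(inv\<^bsub>?G\<^esub> u) \<xi> \<in> carrier H" if "u \<in> carrier ?G" for u
      using unitary_groupD(4)[OF G.inv_closed[OF that] \<xi>] .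
    show "continuous_map ?T mtopology (\<lambda>u. (inv\<^bsub>?G\<^esub> u) \<xi>)"
    proof (rule continuous_map_dominated[OF ips ips,
          where \<phi> = "\<lambda>u u'. u' ((inv\<^bsub>?G\<^esub> u) \<xi>)" and \<omega> = "\<lambda>u u'. u' ((inv\<^bsub>?G\<^esub> u) \<xi>)"])
      fix u u' assume "u \<in> topspace ?T" "u' \<in> topspace ?T"
      then have u: "u \<in> carrier ?G" and u': "u' \<in> carrier ?G"
        by (auto simp: topspace_unitary_group)
      let ?\<eta> = "(inv\<^bsub>?G\<^esub> u) \<xi>"
      have "hnorm H (?\<eta> \<ominus>\<^bsub>H\<^esub> (inv\<^bsub>?G\<^esub> u') \<xi>) = hnorm H (u' ?\<eta> \<ominus>\<^bsub>H\<^esub> u' ((inv\<^bsub>?G\<^esub> u') \<xi>))"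
        by (rule iso[symmetric]) (use u u' mem in auto)
      also have "\<dots> = hdist H (u' ?\<eta>) (u ?\<eta>)"
        using u u' \<xi> mem by (simp add: inv1 hdist_eq unitary_groupD(4))
      also have "\<dots> = hnorm H (u ?\<eta> \<ominus>\<^bsub>H\<^esub> u' ?\<eta>)"
        using u u' mem by (subst commute) (simp add: hdist_eq unitary_groupD(4))
      finally show "hnorm H (?\<eta> \<ominus>\<^bsub>H\<^esub> (inv\<^bsub>?G\<^esub> u') \<xi>)
          \<le> hnorm H (u ?\<eta> \<ominus>\<^bsub>H\<^esub> u' ?\<eta>) + hnorm H (u ?\<eta> \<ominus>\<^bsub>H\<^esub> u' ?\<eta>)"
        using u u' mem by (simp add: unitary_groupD(4))
    qed (auto simp: topspace_unitary_group mem intro: eval)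
  qed (auto simp: topspace_unitary_group)
qed

end

text \<open>
  Representations are thus the same as continuous homomorphisms into the unitary group, to which the
  universal property of free products applies.
\<close>

lemma unitary_representation_continuous_hom:
  assumes "complex_inner_product_space H" "group G" "topspace (topol G) = carrier G"
    and U: "unitary_representation G H U"
  shows "continuous_hom G (unitary_group H) (\<lambda>x. restrict (U x) (carrier H))"
  unfolding continuous_hom_def
proof
  interpret H: complex_inner_product_space H by fact
  interpret G: group G by fact
  note U' = unitary_representationD[OF U]
  have mem: "restrict (U x) (carrier H) \<in> carrier (unitary_group H)" if x: "x \<in> carrier G" for x
    using U x unfolding unitary_representation_def
    by (auto simp: unitary_group_simps unitary_operator_def linear_isometry_def linear_operator_def)
  then show "(\<lambda>x. restrict (U x) (carrier H)) \<in> hom G (unitary_group H)"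
    by (auto simp: hom_def unitary_group_simps(2) compose_def fun_eq_iff U')
  show "continuous_map (topol G) (topol (unitary_group H)) (\<lambda>x. restrict (U x) (carrier H))"
    unfolding H.continuous_map_into_unitary_group using mem U'(4) by (simp add: assms(3))
qed

lemma continuous_hom_unitary_representation:
  assumes "complex_inner_product_space H" "group G"
    and \<Theta>: "continuous_hom G (unitary_group H) \<Theta>"
  shows "unitary_representation G H \<Theta>"
proof (rule unitary_representationI[OF \<open>group G\<close>])
  interpret H: complex_inner_product_space H by fact
  interpret G: group G by fact
  interpret group_hom G "unitary_group H" \<Theta>
    by (intro group_hom.intro group_hom_axioms.intro G.is_group H.unitary_group_group)
      (use \<Theta> in \<open>simp add: continuous_hom_def\<close>)
  have mem: "\<Theta> x \<in> carrier (unitary_group H)" if "x \<in> carrier G" for x using that by simp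
  show "linear_isometry H H (\<Theta> x)" if "x \<in> carrier G" for x
    by (rule unitary_groupD(2)[OF mem[OF that]])
  show "\<Theta> \<one>\<^bsub>G\<^esub> v = v" if "v \<in> carrier H" for v
    using that by (simp add: unitary_group_simps(3))
  show "\<Theta> (x \<otimes>\<^bsub>G\<^esub> y) v = \<Theta> x (\<Theta> y v)" if "x \<in> carrier G" "y \<in> carrier G" "v \<in> carrier H" for x y v
    using that by (simp add: unitary_group_simps(2) compose_def)
  show "continuous_map (topol G) H.mtopology (\<lambda>x. \<Theta> x v)" if "v \<in> carrier H" for v
    using \<Theta> that by (simp add: continuous_hom_def H.continuous_map_into_unitary_group)
qed

section \<open>Dilation spaces consisting of functions\<close>

text \<open>
  The closed linear span of the orbit of the range of \<open>r\<close> is its double orthogonal complement, on which a vector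
  \<open>v\<close> is determined by the function \<open>(x, \<xi>) \<mapsto> cinner K v (V x (r \<xi>))\<close>. So every dilation can be
  replaced by one on a space of functions, whose type depends only on the group and \<open>H\<close>.
\<close>

lemma dilation_on_functions:
  fixes P :: "'p top_monoid" and H :: "'h inner_product_module" and K :: "'k inner_product_module"
  assumes "topological_group P" "complex_inner_product_space H" "hilbert_space K"
    and r: "linear_isometry H K r" and V: "unitary_representation P K V"
  shows "\<exists>(H' :: ('p \<times> 'h \<Rightarrow> complex) inner_product_module) r' U.
    hilbert_space H' \<and> linear_isometry H H' r' \<and> unitary_representation P H' U \<and>
    (\<forall>x\<in>carrier P. \<forall>\<xi>\<in>carrier H. \<forall>\<eta>\<in>carrier H.
      cinner H' (U x (r' \<xi>)) (r' \<eta>) = cinner K (V x (r \<xi>)) (r \<eta>))"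
proof -
  interpret P: topological_group P by fact
  interpret H: complex_inner_product_space H by fact
  interpret K: hilbert_space K by fact
  note V' = unitary_representationD[OF V]
  note r_op = linear_operatorD[OF linear_isometryD(1)[OF r]]
  note V_adj = unitary_representation_cinner[OF P.is_group K.complex_inner_product_space_axioms V]
  define orbit where "orbit = (\<Union>x\<in>carrier P. (\<lambda>\<xi>. V x (r \<xi>)) ` carrier H)"
  define N where "N = orthogonal_complement K orbit"
  define C where "C = orthogonal_complement K N"
  define S where "S = K\<lparr>carrier := C\<rparr>"
  have N_iff: "w \<in> N \<longleftrightarrow> w \<in> carrier K \<and>
      (\<forall>x\<in>carrier P. \<forall>\<xi>\<in>carrier H. cinner K w (V x (r \<xi>)) = 0)" for w
    by (auto simp: N_def orbit_def orthogonal_complement_def)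
  have C_iff: "v \<in> C \<longleftrightarrow> v \<in> carrier K \<and> (\<forall>w\<in>N. cinner K v w = 0)" for v
    by (simp add: C_def orthogonal_complement_def)
  have S: "hilbert_space S"
    unfolding S_def C_def
    by (rule orthogonal_complement_hilbert_space)
      (auto simp: N_iff intro: K.hilbert_space_axioms)
  have S_simps [simp]: "carrier S = C" "x \<oplus>\<^bsub>S\<^esub> y = x \<oplus>\<^bsub>K\<^esub> y" "a \<odot>\<^bsub>S\<^esub> x = a \<odot>\<^bsub>K\<^esub> x"
    "cinner S x y = cinner K x y" "hnorm S x = hnorm K x" for a x y
    by (simp_all add: S_def hnorm_def)
  have rC: "r \<xi> \<in> C" if \<xi>: "\<xi> \<in> carrier H" for \<xi>
  proof -
    have "cinner K (r \<xi>) w = 0" if "w \<in> N" for w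
    proof -
      have "cinner K w (V \<one>\<^bsub>P\<^esub> (r \<xi>)) = 0" "w \<in> carrier K"
        using that \<xi> by (auto simp: N_iff)
      then show ?thesis using K.cinner_commute[of "r \<xi>" w] \<xi> by (simp add: V' r_op)
    qed
    then show ?thesis using \<xi> by (simp add: C_iff r_op)
  qed
  have VN: "V x w \<in> N" if x: "x \<in> carrier P" and w: "w \<in> N" for x w
    unfolding N_iff
  proof (intro conjI ballI)
    have wK: "w \<in> carrier K" using w by (simp add: N_iff)
    then show "V x w \<in> carrier K" using x by (simp add: V')
    fix y \<xi> assume y: "y \<in> carrier P" and \<xi>: "\<xi> \<in> carrier H"
    have "cinner K (V x w) (V y (r \<xi>)) = cinner K w (V (inv\<^bsub>P\<^esub> x) (V y (r \<xi>)))"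
      using x y \<xi> wK by (intro V_adj) (auto simp: V' r_op)
    also have "V (inv\<^bsub>P\<^esub> x) (V y (r \<xi>)) = V (inv\<^bsub>P\<^esub> x \<otimes>\<^bsub>P\<^esub> y) (r \<xi>)"
      using x y \<xi> by (simp add: V' r_op)
    also have "cinner K w \<dots> = 0" using w x y \<xi> by (simp add: N_iff)
    finally show "cinner K (V x w) (V y (r \<xi>)) = 0" .
  qed
  have VC: "V x v \<in> C" if x: "x \<in> carrier P" and v: "v \<in> C" for x v
    unfolding C_iff
  proof (intro conjI ballI)
    have vK: "v \<in> carrier K" using v by (simp add: C_iff)
    then show "V x v \<in> carrier K" using x by (simp add: V')
    fix w assume w: "w \<in> N"
    then have "cinner K (V x v) w = cinner K v (V (inv\<^bsub>P\<^esub> x) w)"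
      using x vK by (intro V_adj) (auto simp: N_iff)
    then show "cinner K (V x v) w = 0"
      using v VN[of "inv\<^bsub>P\<^esub> x" w] x w by (simp add: C_iff)
  qed
  define f where "f v = (\<lambda>(x, \<xi>). cinner K v (V x (r \<xi>)))" for v
  have inj: "inj_on f (carrier S)"
  proof (rule inj_onI)
    fix v w assume vw: "v \<in> carrier S" "w \<in> carrier S" and eq: "f v = f w"
    then have vwK: "v \<in> carrier K" "w \<in> carrier K" by (auto simp: C_iff)
    have "cinner K v (V x (r \<xi>)) = cinner K w (V x (r \<xi>))" for x \<xi>
      using fun_cong[OF eq, of "(x, \<xi>)"] by (simp add: f_def)
    then have "v \<ominus>\<^bsub>K\<^esub> w \<in> N"
      using vwK by (simp add: N_iff K.cinner_diff_left V' r_op)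
    then have "cinner K (v \<ominus>\<^bsub>K\<^esub> w) (v \<ominus>\<^bsub>K\<^esub> w) = 0"
      using vw vwK by (simp add: C_iff K.cinner_diff_left[of v w "v \<ominus>\<^bsub>K\<^esub> w"])
    then have "hnorm K (v \<ominus>\<^bsub>K\<^esub> w) = 0" by (simp add: hnorm_def)
    then show "v = w" using vwK by (simp add: K.hnorm_diff_eq_zero del: K.hnorm_eq_zero_iff)
  qed
  define H' where "H' = transported_space S f"
  define g where "g = inv_into (carrier S) f"
  interpret H': hilbert_space H'
    unfolding H'_def by (rule transported_space(1)[OF S inj])
  have carrier_H': "carrier H' = f ` C"
    unfolding H'_def using transported_space(3)[OF S inj] by simp
  have gf: "g (f v) = v" if "v \<in> C" for v using inj that by (simp add: g_def)
  have fg: "f (g v) = v" if "v \<in> carrier H'" for v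
    using that by (auto simp: carrier_H' gf)
  have "linear_isometry H' S g"
    unfolding H'_def g_def by (rule transported_space(2)[OF S inj])
  then have g: "linear_isometry H' K g"
    by (auto simp: linear_isometry_def linear_operator_def C_iff)
  note g_op = linear_operatorD[OF linear_isometryD(1)[OF g]]
  have g_image: "g ` carrier H' = C"
    by (force simp: carrier_H' gf image_iff)
  have g_cinner: "cinner H' v w = cinner K (g v) (g w)" if "v \<in> carrier H'" "w \<in> carrier H'" for v w
    using that by (intro linear_isometry_cinner[OF _ _ g, symmetric]) unfold_locales
  define r' where "r' \<xi> = f (r \<xi>)" for \<xi>
  have r': "r' \<xi> \<in> carrier H'" "g (r' \<xi>) = r \<xi>" if "\<xi> \<in> carrier H" for \<xi>
    using rC[OF that] by (auto simp: r'_def carrier_H' gf)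
  have eqI: "v = w" if "g v = g w" "v \<in> carrier H'" "w \<in> carrier H'" for v w
    using that fg by metis
  have r'_iso: "linear_isometry H H' r'"
  proof (rule linear_isometryI)
    show "linear_operator H H' r'"
      unfolding linear_operator_def by (auto intro!: eqI simp: r' g_op r_op)
    show "cinner H' (r' \<xi>) (r' \<xi>) = cinner H \<xi> \<xi>" if "\<xi> \<in> carrier H" for \<xi>
      using that linear_isometry_cinner[OF H.complex_inner_product_space_axioms
          K.complex_inner_product_space_axioms r, of \<xi> \<xi>] by (simp add: g_cinner r')
  qed unfold_locales
  define U where "U x v = inv_into (carrier H') g (V x (g v))" for x v
  have U: "unitary_representation P H' U"
    unfolding U_def[abs_def]
    by (rule unitary_representation_pullback[OF P.is_group _ _ g V _ P.topspace_topol])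
      (use VC g_image in \<open>auto intro: H'.complex_inner_product_space_axioms
        K.complex_inner_product_space_axioms\<close>)
  have "cinner H' (U x (r' \<xi>)) (r' \<eta>) = cinner K (V x (r \<xi>)) (r \<eta>)"
    if "x \<in> carrier P" "\<xi> \<in> carrier H" "\<eta> \<in> carrier H" for x \<xi> \<eta>
  proof -
    have "V x (r \<xi>) \<in> g ` carrier H'" using that VC rC by (simp add: g_image)
    then have "g (U x (r' \<xi>)) = V x (r \<xi>)"
      using that by (simp add: U_def r' f_inv_into_f)
    then show ?thesis
      using that r' unitary_representationD(5)[OF U] by (simp add: g_cinner)
  qed
  then show ?thesis
    using H'.hilbert_space_axioms r'_iso U by blast
qed

section \<open>Amalgamating the dilations of the factors\<close>

context isometry_of_hilbert_spaces
begin

text \<open>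
  A unitary representation on a space embedded by \<open>r\<close> acts on the whole space by acting
  trivially on the complement of the range.
\<close>

definition extension :: "('g \<Rightarrow> 'h \<Rightarrow> 'h) \<Rightarrow> 'g \<Rightarrow> 'k \<Rightarrow> 'k" where
  "extension U x v = v \<oplus>\<^bsub>K\<^esub> r (U x (adj v) \<ominus>\<^bsub>H\<^esub> adj v)"

lemma unitary_representation_extension:
  assumes "group G" and top: "topspace (topol G) = carrier G"
    and U: "unitary_representation G H U"
  shows "unitary_representation G K (extension U)"
proof (rule unitary_representationI[OF \<open>group G\<close>])
  interpret G: group G by fact
  note U' = unitary_representationD[OF U]
  have closed_ext [simp]: "extension U x v \<in> carrier K" if "x \<in> carrier G" "v \<in> carrier K" for x v
    using that by (simp add: extension_def U')
  have cinner_ext: "cinner K (extension U x v) w =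
      cinner K v w + cinner H (U x (adj v)) (adj w) - cinner H (adj v) (adj w)"
    if "x \<in> carrier G" "v \<in> carrier K" "w \<in> carrier K" for x v w
    using that by (simp add: extension_def K.cinner_simps H.cinner_simps U'
        cinner_adj_right[symmetric])
  have adj_ext: "adj (extension U x v) = U x (adj v)" if "x \<in> carrier G" "v \<in> carrier K" for x v
    using that by (intro H.vector_eqI)
      (auto simp: extension_def adj_add H.cinner_simps U')
  show "linear_isometry K K (extension U x)" if x: "x \<in> carrier G" for x
  proof (rule linear_isometryI[OF K.complex_inner_product_space_axioms
        K.complex_inner_product_space_axioms])
    note adj_op = linear_operatorD[OF adj_linear]
    note U_op = linear_operatorD[OF linear_isometryD(1)[OF U'(1)[OF x]]]
    show "linear_operator K K (extension U x)"
      unfolding linear_operator_def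
      by (auto intro!: K.vector_eqI
          simp: x cinner_ext K.cinner_simps H.cinner_simps U_op adj_op algebra_simps)
    show "cinner K (extension U x v) (extension U x v) = cinner K v v" if v: "v \<in> carrier K" for v
    proof -
      have "cinner H (U x (adj v)) (U x (adj v)) = cinner H (adj v) (adj v)"
        by (rule linear_isometry_cinner[OF _ _ U'(1)]) (use x v in \<open>auto intro: H.complex_inner_product_space_axioms\<close>)
      moreover have "cinner K v (extension U x v) = cnj (cinner K (extension U x v) v)"
        using x v by (intro K.cinner_commute) auto
      moreover have "cinner K v v = cnj (cinner K v v)"
        "cinner H (adj v) (adj v) = cnj (cinner H (adj v) (adj v))"
        "cinner H (adj v) (U x (adj v)) = cnj (cinner H (U x (adj v)) (adj v))"
        using x v by (auto intro!: K.cinner_commute H.cinner_commute simp: U')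
      ultimately show ?thesis
        using x v by (simp add: cinner_ext adj_ext)
    qed
  qed
  show "extension U \<one>\<^bsub>G\<^esub> v = v" if "v \<in> carrier K" for v
    using that by (intro K.vector_eqI) (auto simp: cinner_ext U')
  show "extension U (x \<otimes>\<^bsub>G\<^esub> y) v = extension U x (extension U y v)"
    if "x \<in> carrier G" "y \<in> carrier G" "v \<in> carrier K" for x y v
    using that by (intro K.vector_eqI) (auto simp: cinner_ext adj_ext U')
  show "continuous_map (topol G) K.mtopology (\<lambda>x. extension U x v)" if v: "v \<in> carrier K" for v
  proof (rule continuous_map_isometric[OF H.complex_inner_product_space_axioms
        K.complex_inner_product_space_axioms U'(4)])
    show "hnorm K (extension U x v \<ominus>\<^bsub>K\<^esub> extension U y v) = hnorm H (U x (adj v) \<ominus>\<^bsub>H\<^esub> U y (adj v))"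
      if "x \<in> topspace (topol G)" "y \<in> topspace (topol G)" for x y
    proof -
      have "extension U x v \<ominus>\<^bsub>K\<^esub> extension U y v = r (U x (adj v) \<ominus>\<^bsub>H\<^esub> U y (adj v))"
        using that v by (intro K.vector_eqI)
          (auto simp: top K.cinner_simps H.cinner_simps cinner_ext U' cinner_adj_right[symmetric])
      then show ?thesis
        using that v linear_isometryD(2)[OF isometry] by (simp add: top U')
    qed
  qed (use v top in auto)
qed

end

text \<open>
  The space \<open>S\<close> contains the amalgamated sum of the Hilbert spaces \<open>K i\<close> over a common subspace \<open>H\<close>: the
  embedded copies of the \<open>K i\<close> meet in the one of \<open>H\<close> and are otherwise orthogonal to each other.
\<close>

locale amalgamated_sum =
  fixes I :: "'i set" and H :: "'h inner_product_module"
    and K :: "'i \<Rightarrow> 'k inner_product_module" and r :: "'i \<Rightarrow> 'h \<Rightarrow> 'k"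
    and S :: "'s inner_product_module" and s :: "'h \<Rightarrow> 's" and E :: "'i \<Rightarrow> 'k \<Rightarrow> 's"
  assumes H: "hilbert_space H" and S: "hilbert_space S"
    and K: "\<And>i. i \<in> I \<Longrightarrow> hilbert_space (K i)"
    and r: "\<And>i. i \<in> I \<Longrightarrow> linear_isometry H (K i) (r i)"
    and s: "linear_isometry H S s"
    and E: "\<And>i. i \<in> I \<Longrightarrow> linear_isometry (K i) S (E i)"
    and E_r: "\<And>i \<xi>. i \<in> I \<Longrightarrow> \<xi> \<in> carrier H \<Longrightarrow> E i (r i \<xi>) = s \<xi>"
    and cinner_E_E: "\<And>i j u v. i \<in> I \<Longrightarrow> j \<in> I \<Longrightarrow> i \<noteq> j \<Longrightarrow>
      u \<in> carrier (K i) \<Longrightarrow> v \<in> carrier (K j) \<Longrightarrow>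
      cinner S (E i u) (E j v) =
      cinner H (adjoint_operator H (K i) (r i) u) (adjoint_operator H (K j) (r j) v)"

text \<open>
  Such a space is the Hilbert sum of the \<open>K i\<close> and one further copy of one of them, which receives
  \<open>H\<close>; the space \<open>K i\<close> is embedded by splitting it into \<open>H\<close> and the complement of \<open>H\<close>.
\<close>

lemma amalgamated_sum_exists:
  fixes H :: "'h inner_product_module" and K :: "'i \<Rightarrow> 'k inner_product_module"
  assumes "I \<noteq> {}" and "hilbert_space H"
    and K_hilbert: "\<And>i. i \<in> I \<Longrightarrow> hilbert_space (K i)"
    and r: "\<And>i. i \<in> I \<Longrightarrow> linear_isometry H (K i) (r i)"
  shows "\<exists>(S :: ('i option \<Rightarrow> 'k) inner_product_module) s E. amalgamated_sum I H K r S s E"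
proof -
  obtain i0 where i0: "i0 \<in> I" using \<open>I \<noteq> {}\<close> by blast
  define J where "J = insert None (Some ` I)"
  define L where "L = case_option (K i0) K"
  interpret hilbert_space_family J L
    by (rule hilbert_space_family.intro) (auto simp: J_def L_def K_hilbert i0)
  interpret H: hilbert_space H by fact
  have J: "None \<in> J" "i \<in> I \<Longrightarrow> Some i \<in> J" for i by (auto simp: J_def)
  have L: "L None = K i0" "L (Some i) = K i" for i by (simp_all add: L_def)
  define inc where "inc = sum_inclusion J L"
  have inc_iso: "linear_isometry (K i0) S (inc None)" "i \<in> I \<Longrightarrow> linear_isometry (K i) S (inc (Some i))" for i
    using sum_inclusion_isometry[OF J(1)] sum_inclusion_isometry[OF J(2)]
    by (simp_all add: inc_def L)
  have K_ips: "complex_inner_product_space (K i)" if "i \<in> I" for i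
    using hilbert_space.axioms(1)[OF K_hilbert[OF that]] .
  have inc_closed: "u \<in> carrier (K i0) \<Longrightarrow> inc None u \<in> carrier S"
    "i \<in> I \<Longrightarrow> u \<in> carrier (K i) \<Longrightarrow> inc (Some i) u \<in> carrier S" for i u
    using inc_iso by (auto dest: linear_isometryD(3))
  have cinner_inc: "u \<in> carrier (K i0) \<Longrightarrow> x \<in> carrier S \<Longrightarrow> cinner S (inc None u) x = cinner (K i0) u (x None)"
    "i \<in> I \<Longrightarrow> v \<in> carrier (K i) \<Longrightarrow> x \<in> carrier S \<Longrightarrow> cinner S (inc (Some i) v) x = cinner (K i) v (x (Some i))"
    for i u v x
    using cinner_sum_inclusion[OF J(1), of u x] cinner_sum_inclusion[OF J(2), of i v x]
    by (simp_all add: inc_def L)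
  have comp: "x None \<in> carrier (K i0)" "i \<in> I \<Longrightarrow> x (Some i) \<in> carrier (K i)"
    if "x \<in> carrier S" for x i
    using component[OF that J(1)] component[OF that J(2)] by (simp_all add: L)
  have orth: "cinner S (inc None u) (inc (Some i) v) = 0"
    "cinner S (inc (Some i) v) (inc None u) = 0"
    if "i \<in> I" "u \<in> carrier (K i0)" "v \<in> carrier (K i)" for i u v
    using that sum_inclusion_orthogonal[of None "Some i" u v]
      sum_inclusion_orthogonal[of "Some i" None v u]
    by (auto simp: inc_def L J)
  have orth': "cinner S (inc (Some i) v) (inc (Some j) w) = 0"
    if "i \<in> I" "j \<in> I" "i \<noteq> j" "v \<in> carrier (K i)" "w \<in> carrier (K j)" for i j v w
    using that sum_inclusion_orthogonal[of "Some i" "Some j" v w] by (auto simp: inc_def L J)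
  have inc_inc: "u \<in> carrier (K i0) \<Longrightarrow> v \<in> carrier (K i0) \<Longrightarrow>
      cinner S (inc None u) (inc None v) = cinner (K i0) u v"
    "i \<in> I \<Longrightarrow> u' \<in> carrier (K i) \<Longrightarrow> v' \<in> carrier (K i) \<Longrightarrow>
      cinner S (inc (Some i) u') (inc (Some i) v') = cinner (K i) u' v'" for i u v u' v'
    using linear_isometry_cinner[OF K_ips[OF i0] sum_ips inc_iso(1)]
      linear_isometry_cinner[OF K_ips sum_ips inc_iso(2)] by auto
  have iso: "isometry_of_hilbert_spaces H (K i) (r i)" if "i \<in> I" for i
    by (intro isometry_of_hilbert_spaces.intro isometry_of_hilbert_spaces_axioms.intro
        assms(2) K_ips r that)
  define a where "a i = adjoint_operator H (K i) (r i)" for i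
  interpret R0: isometry_of_hilbert_spaces H "K i0" "r i0" by (rule iso[OF i0])
  define s where "s \<xi> = inc None (r i0 \<xi>)" for \<xi>
  define E where "E i u = s (a i u) \<oplus>\<^bsub>S\<^esub> inc (Some i) (u \<ominus>\<^bsub>K i\<^esub> r i (a i u))" for i u
  note inc0_op = linear_operatorD[OF linear_isometryD(1)[OF inc_iso(1)]]
  note r0_op = linear_operatorD[OF R0.linear]
  have s_closed: "s \<xi> \<in> carrier S" if "\<xi> \<in> carrier H" for \<xi>
    using that by (simp add: s_def inc_closed)
  have cinner_s: "cinner S (s \<xi>) (s \<eta>) = cinner H \<xi> \<eta>" if "\<xi> \<in> carrier H" "\<eta> \<in> carrier H" for \<xi> \<eta>
    using that by (simp add: s_def inc_inc R0.cinner_image)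
  have s_iso: "linear_isometry H S s"
  proof (rule linear_isometryI)
    show "linear_operator H S s"
      by (auto simp: linear_operator_def s_def inc_closed inc0_op r0_op)
  qed (use cinner_s in \<open>auto intro: H.complex_inner_product_space_axioms sum_ips\<close>)
  note s_op = linear_operatorD[OF linear_isometryD(1)[OF s_iso]]
  have E: "linear_isometry (K i) S (E i)" "\<xi> \<in> carrier H \<Longrightarrow> E i (r i \<xi>) = s \<xi>" if i: "i \<in> I" for i \<xi>
  proof -
    interpret R: isometry_of_hilbert_spaces H "K i" "r i" by (rule iso[OF i])
    note a_op = linear_operatorD[OF R.adj_linear] and r_op = linear_operatorD[OF R.linear]
    note inc_op = linear_operatorD[OF linear_isometryD(1)[OF inc_iso(2)[OF i]]]
    have ai: "a i = R.adj" by (simp add: a_def)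
    have E_closed: "E i u \<in> carrier S" if "u \<in> carrier (K i)" for u
      using that i by (simp add: E_def ai s_closed inc_closed)
    have cinner_E: "cinner S (E i u) x = cinner S (s (a i u)) x + cinner (K i) u (x (Some i))
        - cinner (K i) (r i (a i u)) (x (Some i))" if "u \<in> carrier (K i)" "x \<in> carrier S" for u x
      using that i by (simp add: E_def ai s_closed inc_closed S.cinner_simps R.K.cinner_simps
          cinner_inc comp)
    show "linear_isometry (K i) S (E i)"
    proof (rule linear_isometryI[OF K_ips[OF i] sum_ips])
      show "linear_operator (K i) S (E i)"
        unfolding linear_operator_def
        by (auto intro!: S.vector_eqI simp: E_closed cinner_E S.cinner_simps R.K.cinner_simps
            ai a_op s_op r_op comp i algebra_simps)
      show "cinner S (E i u) (E i u) = cinner (K i) u u" if u: "u \<in> carrier (K i)" for u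
        using u i by (simp add: E_def ai s_closed inc_closed S.cinner_simps cinner_s)
          (simp add: s_def orth inc_inc R.K.cinner_simps R.cinner_image R.cinner_adj[symmetric]
            R.cinner_adj_right[symmetric] R.adj_diff H.cinner_simps)
    qed
    show "E i (r i \<xi>) = s \<xi>" if "\<xi> \<in> carrier H"
      using that i by (intro S.vector_eqI) (auto simp: E_closed s_closed cinner_E ai)
  qed
  have EE: "cinner S (E i u) (E j v) = cinner H (a i u) (a j v)"
    if i: "i \<in> I" and j: "j \<in> I" and "i \<noteq> j" and u: "u \<in> carrier (K i)" and v: "v \<in> carrier (K j)"
    for i j u v
  proof -
    interpret Ri: isometry_of_hilbert_spaces H "K i" "r i" by (rule iso[OF i])
    interpret Rj: isometry_of_hilbert_spaces H "K j" "r j" by (rule iso[OF j])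
    have a: "a i u \<in> carrier H" "a j v \<in> carrier H" using u v by (simp_all add: a_def)
    have "u \<ominus>\<^bsub>K i\<^esub> r i (a i u) \<in> carrier (K i)" "v \<ominus>\<^bsub>K j\<^esub> r j (a j v) \<in> carrier (K j)"
      using u v a by simp_all
    then show ?thesis
      using a i j \<open>i \<noteq> j\<close> by (simp add: E_def s_closed inc_closed S.cinner_simps cinner_s)
        (simp add: s_def orth orth')
  qed
  have "amalgamated_sum I H K r S s E"
    by (rule amalgamated_sum.intro)
      (use assms(2) K_hilbert r hilbert_sum_hilbert_space s_iso E EE in \<open>auto simp: a_def\<close>)
  then show ?thesis by blast
qed

section \<open>Dilations of semigroups over free products\<close>

lemma word_product_Nil: "word_product P \<iota> [] = \<one>\<^bsub>P\<^esub>"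
  and word_product_Cons: "word_product P \<iota> ((i, x) # w) = \<iota> i x \<otimes>\<^bsub>P\<^esub> word_product P \<iota> w"
  by (simp_all add: word_product_def)

lemma (in topological_group) factor_in_free_product_submonoid:
  assumes "i \<in> I" "x \<in> M i" "\<iota> i x \<in> carrier G"
  shows "\<iota> i x \<in> free_product_submonoid I G \<iota> M"
  unfolding free_product_submonoid_def
  by (rule image_eqI[of _ _ "[(i, x)]"]) (use assms in \<open>auto simp: word_product_Nil word_product_Cons\<close>)

text \<open>
  In the induction over the word \<open>w\<close>, a vector is called \<^emph>\<open>coherent\<close> if, for each factor, the compressions
  to \<open>H\<close> of its translates are governed by its own compression. The vectors of \<open>H\<close> are coherent since
  \<open>V i\<close> dilates \<open>t i\<close>. Coherence is preserved by the operators \<open>V j y\<close>: under the same factor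
  since \<open>t j\<close> is multiplicative, and under a different factor \<open>i\<close> since the projection
  to \<open>K i\<close> sees of \<open>V j y v - v\<close> only the change of the compression to \<open>H\<close>. So the compression of
  each product of operators \<open>V i x\<close> is computed one factor at a time.
\<close>

lemma (in amalgamated_sum) compression_of_products:
  fixes G :: "'i \<Rightarrow> 'g top_monoid" and t :: "'i \<Rightarrow> 'g \<Rightarrow> 'h \<Rightarrow> 'h"
  assumes G: "\<And>i. i \<in> I \<Longrightarrow> topological_group (G i)"
    and M: "\<And>i. i \<in> I \<Longrightarrow> submonoid (M i) (G i)"
    and U: "\<And>i. i \<in> I \<Longrightarrow> unitary_representation (G i) (K i) (U i)"
    and t_op: "\<And>i x. i \<in> I \<Longrightarrow> x \<in> M i \<Longrightarrow> linear_operator H H (t i x)"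
    and t_mult: "\<And>i x y \<xi>. i \<in> I \<Longrightarrow> x \<in> M i \<Longrightarrow> y \<in> M i \<Longrightarrow> \<xi> \<in> carrier H \<Longrightarrow>
      t i (x \<otimes>\<^bsub>G i\<^esub> y) \<xi> = t i x (t i y \<xi>)"
    and dil: "\<And>i x \<xi> \<eta>. i \<in> I \<Longrightarrow> x \<in> M i \<Longrightarrow> \<xi> \<in> carrier H \<Longrightarrow> \<eta> \<in> carrier H \<Longrightarrow>
      cinner H (t i x \<xi>) \<eta> = cinner (K i) (U i x (r i \<xi>)) (r i \<eta>)"
    and w: "w \<in> lists (SIGMA i:I. M i)" and \<xi>: "\<xi> \<in> carrier H"
  defines "V \<equiv> \<lambda>i. isometry_of_hilbert_spaces.extension (K i) S (E i) (U i)"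
  shows "adjoint_operator H S s (foldr (\<lambda>(i, x). V i x) w (s \<xi>)) = foldr (\<lambda>(i, x). t i x) w \<xi>"
proof -
  interpret s: isometry_of_hilbert_spaces H S s
    by (intro isometry_of_hilbert_spaces.intro isometry_of_hilbert_spaces_axioms.intro H s
        hilbert_space.axioms(1)[OF S])
  have r_iso: "isometry_of_hilbert_spaces H (K i) (r i)" if "i \<in> I" for i
    by (intro isometry_of_hilbert_spaces.intro isometry_of_hilbert_spaces_axioms.intro H r that
        hilbert_space.axioms(1)[OF K])
  have E_iso: "isometry_of_hilbert_spaces (K i) S (E i)" if "i \<in> I" for i
    by (intro isometry_of_hilbert_spaces.intro isometry_of_hilbert_spaces_axioms.intro K E that
        hilbert_space.axioms(1)[OF S])
  \<comment> \<open>The projections from \<open>S\<close> to \<open>H\<close>, from \<open>K i\<close> to \<open>H\<close> and from \<open>S\<close> to \<open>K i\<close>.\<close>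
  define c where "c = adjoint_operator H S s"
  define a where "a i = adjoint_operator H (K i) (r i)" for i
  define b where "b i = adjoint_operator (K i) S (E i)" for i
  have MG: "x \<in> carrier (G i)" if "i \<in> I" "x \<in> M i" for i x
    using submonoid.subset[OF M[OF that(1)]] that by auto
  have V_rep: "unitary_representation (G i) S (V i)" if "i \<in> I" for i
    unfolding V_def using G[OF that] U[OF that]
    by (intro isometry_of_hilbert_spaces.unitary_representation_extension[OF E_iso[OF that]])
      (auto simp: topological_group_def topological_group_axioms_def)
  note V' = unitary_representationD[OF V_rep]
  have c_closed [simp]: "c v \<in> carrier H" if "v \<in> carrier S" for v
    using that by (simp add: c_def)
  have c_b: "c v = a i (b i v)" if i: "i \<in> I" and v: "v \<in> carrier S" for i v
  proof -
    interpret r: isometry_of_hilbert_spaces H "K i" "r i" by (rule r_iso[OF i])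
    interpret E: isometry_of_hilbert_spaces "K i" S "E i" by (rule E_iso[OF i])
    show ?thesis
      by (rule s.H.vector_eqI)
        (use v in \<open>auto simp: c_def a_def b_def s.cinner_adj r.cinner_adj E.cinner_adj E_r[OF i]\<close>)
  qed
  have b_V: "b i (V i x v) = U i x (b i v)" if i: "i \<in> I" and x: "x \<in> carrier (G i)" and v: "v \<in> carrier S"
    for i x v
  proof -
    interpret E: isometry_of_hilbert_spaces "K i" S "E i" by (rule E_iso[OF i])
    show ?thesis
      using x v unitary_representationD(5)[OF U[OF i] x]
      by (intro E.H.vector_eqI) (auto simp: V_def b_def E.extension_def E.adj_add E.H.cinner_simps)
  qed
  \<comment> \<open>Seen from the embedded space \<open>K i\<close>, the operators of the other factors act only through \<open>H\<close>.\<close>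
  have b_V_other: "b i (V j x v) = b i v \<oplus>\<^bsub>K i\<^esub> r i (c (V j x v) \<ominus>\<^bsub>H\<^esub> c v)"
    if i: "i \<in> I" and j: "j \<in> I" and ij: "i \<noteq> j" and x: "x \<in> carrier (G j)" and v: "v \<in> carrier S"
    for i j x v
  proof -
    interpret ri: isometry_of_hilbert_spaces H "K i" "r i" by (rule r_iso[OF i])
    interpret rj: isometry_of_hilbert_spaces H "K j" "r j" by (rule r_iso[OF j])
    interpret Ei: isometry_of_hilbert_spaces "K i" S "E i" by (rule E_iso[OF i])
    interpret Ej: isometry_of_hilbert_spaces "K j" S "E j" by (rule E_iso[OF j])
    have Ux: "U j x (b j v) \<in> carrier (K j)"
      using x v unitary_representationD(5)[OF U[OF j] x] by (simp add: b_def)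
    define d where "d = U j x (b j v) \<ominus>\<^bsub>K j\<^esub> b j v"
    have d: "d \<in> carrier (K j)" using Ux v by (simp add: d_def b_def)
    have Vd: "V j x v = v \<oplus>\<^bsub>S\<^esub> E j d" by (simp add: V_def Ej.extension_def d_def b_def)
    have Vc: "V j x v \<in> carrier S" using V'(5)[OF j x v] .
    have "c (V j x v) \<ominus>\<^bsub>H\<^esub> c v = a j d"
      unfolding c_b[OF j Vc] c_b[OF j v] b_V[OF j x v] a_def d_def
      using rj.adj_diff[OF Ux, of "b j v"] v by (simp add: b_def)
    then show ?thesis
      using d v ij by (intro ri.K.vector_eqI)
        (auto simp: Vd b_def Ei.adj_add ri.K.cinner_simps Ei.cinner_adj cinner_E_E[OF j i, symmetric]
          a_def ri.cinner_adj_right[symmetric])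
  qed
  have a_U_r: "a i (U i x (r i \<zeta>)) = t i x \<zeta>" if i: "i \<in> I" and x: "x \<in> M i" and \<zeta>: "\<zeta> \<in> carrier H" for i x \<zeta>
  proof -
    interpret r: isometry_of_hilbert_spaces H "K i" "r i" by (rule r_iso[OF i])
    show ?thesis
      unfolding a_def using i x \<zeta> linear_operatorD(1)[OF t_op[OF i x]] by (intro r.adj_unique) (auto simp: dil)
  qed
  define coherent where "coherent v \<longleftrightarrow> v \<in> carrier S \<and> (\<forall>i\<in>I. \<forall>z\<in>M i. c (V i z v) = t i z (c v))" for v
  have start: "coherent (s \<zeta>)" if \<zeta>: "\<zeta> \<in> carrier H" for \<zeta>
  proof -
    have "c (V i z (s \<zeta>)) = t i z (c (s \<zeta>))" if i: "i \<in> I" and z: "z \<in> M i" for i z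
    proof -
      interpret r: isometry_of_hilbert_spaces H "K i" "r i" by (rule r_iso[OF i])
      interpret E: isometry_of_hilbert_spaces "K i" S "E i" by (rule E_iso[OF i])
      have "b i (s \<zeta>) = r i \<zeta>" using \<zeta> i by (simp add: b_def flip: E_r)
      then show ?thesis
        using i z \<zeta> MG V' by (simp add: c_b[of i "V i z (s \<zeta>)"] b_V a_U_r) (simp add: c_def)
    qed
    then show ?thesis using \<zeta> by (simp add: coherent_def)
  qed
  have step: "coherent (V j y v)" if v: "coherent v" and j: "j \<in> I" and y: "y \<in> M j" for j y v
  proof -
    have vS: "v \<in> carrier S" using v by (simp add: coherent_def)
    have cv: "c (V i z v) = t i z (c v)" if "i \<in> I" "z \<in> M i" for i z
      using v that by (simp add: coherent_def)
    have VS: "V j y v \<in> carrier S" by (rule V'(5)[OF j MG[OF j y] vS])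
    have "c (V i z (V j y v)) = t i z (c (V j y v))" if i: "i \<in> I" and z: "z \<in> M i" for i z
    proof (cases "i = j")
      case True
      have "c (V i z (V i y v)) = c (V i (z \<otimes>\<^bsub>G i\<^esub> y) v)"
        using True i y z vS by (simp add: V'(3) MG)
      also have "\<dots> = t i z (t i y (c v))"
        using True i y z vS submonoid.m_closed[OF M[OF i]] by (simp add: cv t_mult)
      finally show ?thesis using True i y by (simp add: cv)
    next
      case False
      interpret r: isometry_of_hilbert_spaces H "K i" "r i" by (rule r_iso[OF i])
      interpret E: isometry_of_hilbert_spaces "K i" S "E i" by (rule E_iso[OF i])
      let ?\<delta> = "c (V j y v) \<ominus>\<^bsub>H\<^esub> c v"
      have \<delta>: "?\<delta> \<in> carrier H" using VS vS by simp
      note U_iso = unitary_representationD(1)[OF U[OF i] MG[OF i z]]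
      note U_op = linear_operatorD[OF linear_isometryD(1)[OF U_iso]]
      note t_lin = linear_operatorD[OF t_op[OF i z]]
      have bv: "b i v \<in> carrier (K i)" using vS by (simp add: b_def)
      have "c (V i z (V j y v)) = a i (U i z (b i v \<oplus>\<^bsub>K i\<^esub> r i ?\<delta>))"
        by (simp only: c_b[OF i V'(5)[OF i MG[OF i z] VS]] b_V[OF i MG[OF i z] VS]
            b_V_other[OF i j False MG[OF j y] vS])
      also have "\<dots> = a i (U i z (b i v)) \<oplus>\<^bsub>H\<^esub> a i (U i z (r i ?\<delta>))"
        using bv \<delta> by (simp add: U_op a_def r.adj_add)
      also have "a i (U i z (b i v)) = t i z (c v)"
        using cv[OF i z] by (simp only: c_b[OF i V'(5)[OF i MG[OF i z] vS]] b_V[OF i MG[OF i z] vS])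
      also have "a i (U i z (r i ?\<delta>)) = t i z (c (V j y v)) \<ominus>\<^bsub>H\<^esub> t i z (c v)"
        unfolding a_U_r[OF i z \<delta>]
        by (rule linear_operator_diff[OF _ _ t_op[OF i z]])
          (use VS vS in \<open>auto intro: s.H.complex_inner_product_space_axioms\<close>)
      also have "t i z (c v) \<oplus>\<^bsub>H\<^esub> (t i z (c (V j y v)) \<ominus>\<^bsub>H\<^esub> t i z (c v)) = t i z (c (V j y v))"
        using VS vS t_lin(1) by (intro s.H.vector_eqI) (auto simp: s.H.cinner_simps)
      finally show ?thesis .
    qed
    then show ?thesis using VS by (simp add: coherent_def)
  qed
  have "coherent (foldr (\<lambda>(i, x). V i x) w (s \<xi>)) \<and>
      c (foldr (\<lambda>(i, x). V i x) w (s \<xi>)) = foldr (\<lambda>(i, x). t i x) w \<xi>"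
    using w
  proof (induction w)
    case Nil
    then show ?case using start[OF \<xi>] \<xi> by (simp add: c_def)
  next
    case (Cons p w)
    obtain i x where p: "p = (i, x)" by (cases p)
    then have ix: "i \<in> I" "x \<in> M i" using Cons.hyps by auto
    then show ?case using Cons.IH step by (auto simp: p coherent_def)
  qed
  then show ?thesis by (simp add: c_def)
qed

theorem theorem5p10:
  fixes I :: "'i set"
    and G :: "'i \<Rightarrow> 'g top_monoid" and M :: "'i \<Rightarrow> 'g set"
    and P :: "'p top_monoid" and \<iota> :: "'i \<Rightarrow> 'g \<Rightarrow> 'p"
    and H :: "'h inner_product_module" and T :: "'p \<Rightarrow> 'h \<Rightarrow> 'h"
  assumes "I \<noteq> {}"
    and "hilbert_space H"
    and "\<And>i. i \<in> I \<Longrightarrow> (G i, M i) \<in> class_M2 TYPE('h) TYPE('k)"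
    and "free_topological_product I G P \<iota>"
    and "contractive_semigroup (top_submonoid P (free_product_submonoid I P \<iota> M)) H T"
  shows "\<exists>(H' :: ('p \<times> 'h \<Rightarrow> complex) inner_product_module) r U.
    hilbert_space H' \<and> linear_isometry H H' r \<and> unitary_representation P H' U \<and>
    (\<forall>x\<in>free_product_submonoid I P \<iota> M. \<forall>\<xi>\<in>carrier H.
      T x \<xi> = adjoint_operator H H' r (U x (r \<xi>)))"
proof -
  let ?N = "free_product_submonoid I P \<iota> M"
  interpret H: hilbert_space H by fact
  have "topological_group P"
    and \<iota>: "\<And>i. i \<in> I \<Longrightarrow> continuous_hom (G i) P (\<iota> i)"
    using assms(4) by (auto simp: free_topological_product_def)
  interpret P: topological_group P by fact
  have G: "topological_group (G i)" and M: "submonoid (M i) (G i)" if "i \<in> I" for i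
    using assms(3)[OF that] by (auto simp: class_M2_def)
  have MG: "x \<in> carrier (G i)" if "i \<in> I" "x \<in> M i" for i x
    using submonoid.subset[OF M[OF that(1)]] that by auto
  have \<iota>_P: "\<iota> i x \<in> carrier P" if "i \<in> I" "x \<in> carrier (G i)" for i x
    using \<iota>[OF that(1)] that(2) by (auto simp: continuous_hom_def hom_def)
  have \<iota>_mult: "\<iota> i (x \<otimes>\<^bsub>G i\<^esub> y) = \<iota> i x \<otimes>\<^bsub>P\<^esub> \<iota> i y"
    if "i \<in> I" "x \<in> carrier (G i)" "y \<in> carrier (G i)" for i x y
    using \<iota>[OF that(1)] that(2,3) by (auto simp: continuous_hom_def hom_def)
  have \<iota>_N: "\<iota> i x \<in> ?N" if "i \<in> I" "x \<in> M i" for i x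
    using that by (intro P.factor_in_free_product_submonoid \<iota>_P MG)
  have N_P: "?N \<subseteq> carrier P"
    using P.word_product_closed[of I M \<iota>] \<iota>_P MG
    by (auto simp: free_product_submonoid_def word_product_def)
  have T_contr: "\<And>x. x \<in> ?N \<Longrightarrow> contraction H (T x)"
    and T_one: "\<And>\<xi>. \<xi> \<in> carrier H \<Longrightarrow> T \<one>\<^bsub>P\<^esub> \<xi> = \<xi>"
    and T_mult: "\<And>x y \<xi>. x \<in> ?N \<Longrightarrow> y \<in> ?N \<Longrightarrow> \<xi> \<in> carrier H \<Longrightarrow> T (x \<otimes>\<^bsub>P\<^esub> y) \<xi> = T x (T y \<xi>)"
    and T_cont: "\<And>\<xi>. \<xi> \<in> carrier H \<Longrightarrow> continuous_map (subtopology (topol P) ?N) H.mtopology (\<lambda>x. T x \<xi>)"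
    using assms(5)
    by (auto simp: contractive_semigroup_def operator_homomorphism_def strongly_continuous_def
        top_submonoid_def)
  define t where "t i x = T (\<iota> i x)" for i x
  have t_semigroup: "contractive_semigroup (top_submonoid (G i) (M i)) H (t i)" if i: "i \<in> I" for i
    unfolding contractive_semigroup_def operator_homomorphism_def strongly_continuous_def
  proof (intro conjI ballI)
    have Gi: "group (G i)" using G[OF i] by (rule topological_group.axioms)
    have "\<iota> i \<one>\<^bsub>G i\<^esub> = \<one>\<^bsub>P\<^esub>"
      using \<iota>[OF i] by (intro hom_one[OF _ Gi P.is_group]) (simp add: continuous_hom_def)
    then show "t i \<one>\<^bsub>top_submonoid (G i) (M i)\<^esub> \<xi> = \<xi>" if "\<xi> \<in> carrier H" for \<xi>
      using that by (simp add: t_def top_submonoid_def T_one)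
    show "continuous_map (topol (top_submonoid (G i) (M i))) H.mtopology (\<lambda>x. t i x \<xi>)"
      if "\<xi> \<in> carrier H" for \<xi>
    proof -
      have "continuous_map (subtopology (topol (G i)) (M i)) (subtopology (topol P) ?N) (\<iota> i)"
        using \<iota>[OF i] \<iota>_N[OF i]
        by (auto simp: continuous_hom_def continuous_map_in_subtopology continuous_map_from_subtopology)
      from continuous_map_compose[OF this T_cont[OF that]] show ?thesis
        by (simp add: t_def top_submonoid_def o_def)
    qed
  qed (auto simp: top_submonoid_def t_def \<iota>_mult MG[OF i] i T_mult \<iota>_N T_contr)
  have "\<exists>(K :: 'k inner_product_module) r U.
      hilbert_space K \<and> linear_isometry H K r \<and> unitary_representation (G i) K U \<and>
      (\<forall>x\<in>M i. \<forall>\<xi>\<in>carrier H. t i x \<xi> = adjoint_operator H K r (U x (r \<xi>)))" if i: "i \<in> I" for i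
    using assms(3)[OF i] t_semigroup[OF i] assms(2) unfolding class_M2_def by blast
  then obtain K :: "'i \<Rightarrow> 'k inner_product_module" and r U where
    K: "\<And>i. i \<in> I \<Longrightarrow> hilbert_space (K i)"
    and r: "\<And>i. i \<in> I \<Longrightarrow> linear_isometry H (K i) (r i)"
    and U: "\<And>i. i \<in> I \<Longrightarrow> unitary_representation (G i) (K i) (U i)"
    and U_dil: "\<And>i x \<xi>. i \<in> I \<Longrightarrow> x \<in> M i \<Longrightarrow> \<xi> \<in> carrier H \<Longrightarrow>
      t i x \<xi> = adjoint_operator H (K i) (r i) (U i x (r i \<xi>))"
    by metis
  obtain S :: "('i option \<Rightarrow> 'k) inner_product_module" and s E where
    sum: "amalgamated_sum I H K r S s E"
    using amalgamated_sum_exists[of I H K r] assms(1,2) K r by blast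
  note S = amalgamated_sum.S[OF sum] and s = amalgamated_sum.s[OF sum]
    and E = amalgamated_sum.E[OF sum]
  interpret s: isometry_of_hilbert_spaces H S s
    by (intro isometry_of_hilbert_spaces.intro isometry_of_hilbert_spaces_axioms.intro assms(2) s
        hilbert_space.axioms(1)[OF S])
  define W where "W i = isometry_of_hilbert_spaces.extension (K i) S (E i) (U i)" for i
  have W: "unitary_representation (G i) S (W i)" if i: "i \<in> I" for i
  proof -
    interpret E: isometry_of_hilbert_spaces "K i" S "E i"
      by (intro isometry_of_hilbert_spaces.intro isometry_of_hilbert_spaces_axioms.intro K E i
          hilbert_space.axioms(1)[OF S])
    interpret Gi: topological_group "G i" by (rule G[OF i])
    show ?thesis
      unfolding W_def by (rule E.unitary_representation_extension[OF Gi.is_group Gi.topspace_topol U[OF i]])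
  qed
  have "\<exists>V. continuous_hom P (unitary_group S) V \<and>
      (\<forall>i\<in>I. \<forall>x\<in>carrier (G i). V (\<iota> i x) = restrict (W i x) (carrier S))"
  proof (rule free_topological_product_universal[OF G assms(4) s.K.unitary_group_topological_group])
    fix i assume i: "i \<in> I"
    interpret Gi: topological_group "G i" by (rule G[OF i])
    show "continuous_hom (G i) (unitary_group S) (\<lambda>x. restrict (W i x) (carrier S))"
      by (rule unitary_representation_continuous_hom[OF s.K.complex_inner_product_space_axioms
            Gi.is_group Gi.topspace_topol W[OF i]])
  qed
  then obtain V where V: "continuous_hom P (unitary_group S) V"
    and V_W: "\<And>i x. i \<in> I \<Longrightarrow> x \<in> carrier (G i) \<Longrightarrow> V (\<iota> i x) = restrict (W i x) (carrier S)"
    by blast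
  have V_rep: "unitary_representation P S V"
    by (rule continuous_hom_unitary_representation[OF s.K.complex_inner_product_space_axioms
          P.is_group V])
  note V' = unitary_representationD[OF V_rep]
  have words: "word_product P \<iota> w \<in> carrier P \<and> word_product P \<iota> w \<in> ?N \<and>
      V (word_product P \<iota> w) v = foldr (\<lambda>(i, x). W i x) w v \<and>
      T (word_product P \<iota> w) \<xi> = foldr (\<lambda>(i, x). t i x) w \<xi>"
    if w: "w \<in> lists (SIGMA i:I. M i)" and v: "v \<in> carrier S" and \<xi>: "\<xi> \<in> carrier H" for w v \<xi>
    using w
  proof (induction w)
    case Nil
    then show ?case
      using v \<xi> by (auto simp: word_product_Nil V' T_one free_product_submonoid_def intro: image_eqI[of _ _ "[]"])
  next
    case (Cons p w)
    obtain i x where p: "p = (i, x)" by (cases p)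
    then have ix: "i \<in> I" "x \<in> M i" "x \<in> carrier (G i)" using Cons.hyps MG by auto
    have "word_product P \<iota> (p # w) \<in> ?N"
      unfolding free_product_submonoid_def using Cons.hyps by (intro imageI) auto
    moreover have "V (word_product P \<iota> (p # w)) v = W i x (V (word_product P \<iota> w) v)"
      using Cons.IH ix v V'(5)[of "word_product P \<iota> w" v]
      by (simp add: p word_product_Cons V'(3) \<iota>_P V_W)
    moreover have "T (word_product P \<iota> (p # w)) \<xi> = t i x (T (word_product P \<iota> w) \<xi>)"
      using Cons.IH ix \<xi> by (simp add: p word_product_Cons T_mult \<iota>_N t_def)
    ultimately show ?case
      using Cons.IH N_P by (auto simp: p)
  qed
  have dilation: "cinner H (T x \<xi>) \<eta> = cinner S (V x (s \<xi>)) (s \<eta>)"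
    if x: "x \<in> ?N" and \<xi>: "\<xi> \<in> carrier H" and \<eta>: "\<eta> \<in> carrier H" for x \<xi> \<eta>
  proof -
    obtain w where w: "w \<in> lists (SIGMA i:I. M i)" and xw: "x = word_product P \<iota> w"
      using x by (auto simp: free_product_submonoid_def)
    have "s.adj (foldr (\<lambda>(i, x). W i x) w (s \<xi>)) = foldr (\<lambda>(i, x). t i x) w \<xi>"
      unfolding W_def
    proof (rule amalgamated_sum.compression_of_products[OF sum G M U])
      fix i assume i: "i \<in> I"
      show "linear_operator H H (t i x)" if "x \<in> M i" for x
        using T_contr[OF \<iota>_N[OF i that]] by (simp add: t_def contraction_def)
      show "t i (x \<otimes>\<^bsub>G i\<^esub> y) \<zeta> = t i x (t i y \<zeta>)" if "x \<in> M i" "y \<in> M i" "\<zeta> \<in> carrier H" for x y \<zeta>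
        using that i by (simp add: t_def \<iota>_mult MG T_mult \<iota>_N)
      show "cinner H (t i x \<zeta>) \<zeta>' = cinner (K i) (U i x (r i \<zeta>)) (r i \<zeta>')"
        if "x \<in> M i" "\<zeta> \<in> carrier H" "\<zeta>' \<in> carrier H" for x \<zeta> \<zeta>'
      proof -
        interpret r: isometry_of_hilbert_spaces H "K i" "r i"
          by (intro isometry_of_hilbert_spaces.intro isometry_of_hilbert_spaces_axioms.intro
              assms(2) r i hilbert_space.axioms(1)[OF K])
        show ?thesis
          using that i unitary_representationD(5)[OF U[OF i] MG[OF i that(1)]]
          by (simp add: U_dil r.cinner_adj)
      qed
    qed (use w \<xi> in auto)
    then have "s.adj (V x (s \<xi>)) = T x \<xi>"
      using words[OF w _ \<xi>, of "s \<xi>"] \<xi> by (simp add: xw)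
    then show ?thesis
      using s.cinner_adj[of "V x (s \<xi>)" \<eta>] V'(5)[of x "s \<xi>"] x N_P \<xi> \<eta> by auto
  qed
  obtain H' :: "('p \<times> 'h \<Rightarrow> complex) inner_product_module" and r' U' where
    H': "hilbert_space H'" and r': "linear_isometry H H' r'" and U': "unitary_representation P H' U'"
    and eq: "\<forall>x\<in>carrier P. \<forall>\<xi>\<in>carrier H. \<forall>\<eta>\<in>carrier H.
      cinner H' (U' x (r' \<xi>)) (r' \<eta>) = cinner S (V x (s \<xi>)) (s \<eta>)"
    using dilation_on_functions[OF \<open>topological_group P\<close> H.complex_inner_product_space_axioms S s V_rep] by blast
  interpret r': isometry_of_hilbert_spaces H H' r'
    by (intro isometry_of_hilbert_spaces.intro isometry_of_hilbert_spaces_axioms.intro assms(2) r'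
        hilbert_space.axioms(1)[OF H'])
  have "T x \<xi> = r'.adj (U' x (r' \<xi>))" if x: "x \<in> ?N" and \<xi>: "\<xi> \<in> carrier H" for x \<xi>
  proof (rule r'.adj_unique[symmetric])
    show "T x \<xi> \<in> carrier H"
      using T_contr[OF x] \<xi> by (simp add: contraction_def linear_operator_def)
    show "cinner H (T x \<xi>) \<eta> = cinner H' (U' x (r' \<xi>)) (r' \<eta>)" if "\<eta> \<in> carrier H" for \<eta>
      using dilation[OF x \<xi> that] eq x N_P \<xi> that by auto
  qed
  with H' r' U' show ?thesis by blast
qed

end
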